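(* Let $(R,P_\Omega)$ be a multiple Rota-Baxter algebra of pair weight $(\lambda_\Omega,\lambda_\Omega)$. Every free left $(R,P_\Omega)$-module is flat.
   Context: $\mathbf{k}$ is a commutative unital ring; algebras are associative unital $\mathbf{k}$-algebras, modules are unital, "linear" means $\mathbf{k}$-linear. $\Omega$ is a nonempty set and $\lambda_\Omega=(\lambda_\omega)_{\omega\in\Omega}$ a family of elements of $\mathbf{k}$. A multiple Rota-Baxter algebra $(R,P_\Omega)$ of pair weight $(\lambda_\Omega,\lambda_\Omega)$ is an algebra $R$ with linear operators $P_\omega:R\to R$ ($\omega\in\Omega$) such that $P_\alpha(r)P_\beta(s)=P_\alpha(rP_\beta(s))+P_\beta(P_\alpha(r)s)+\lambda_\beta P_\alpha(rs)+\lambda_\alpha P_\beta(rs)$ for all $r,s\in R$, $\alpha,\beta\in\Omega$. A left $(R,P_\Omega)$-module $(M,\mathfrak{m}_\Omega)$ is a left $R$-module $M$ with linear operators $\mathfrak{m}_\omega:M\to M$ such that $P_\alpha(r)\mathfrak{m}_\beta(m)=\mathfrak{m}_\alpha(r\mathfrak{m}_\beta(m))+\mathfrak{m}_\beta(P_\alpha(r)m)+\lambda_\beta\mathfrak{m}_\alpha(rm)+\lambda_\alpha\mathfrak{m}_\beta(rm)$ for all $r\in R,m\in M,\alpha,\beta\in\Omega$. A right $(R,P_\Omega)$-module $(S,\mathfrak{s}_\Omega)$ is a right $R$-module $S$ with linear operators $\mathfrak{s}_\omega:S\to S$ such that $\mathfrak{s}_\beta(sP_\alpha(r))=\mathfrak{s}_\beta(\mathfrak{s}_\alpha(s)r)+\mathfrak{s}_\beta(s)P_\alpha(r)+\lambda_\beta\mathfrak{s}_\alpha(s)r+\lambda_\alpha\mathfrak{s}_\beta(s)r$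 for all $r\in R,s\in S,\alpha,\beta\in\Omega$. Homomorphisms of left (right) $(R,P_\Omega)$-modules are left (right) $R$-module homomorphisms commuting with the operators indexed by each $\omega\in\Omega$. A free left $(R,P_\Omega)$-module on a set $X$ is a left $(R,P_\Omega)$-module $F$ with a set map $j_X:X\to F$ such that for every left $(R,P_\Omega)$-module $M$ and set map $\varphi:X\to M$ there is a unique left $(R,P_\Omega)$-module homomorphism $\widetilde\varphi:F\to M$ with $\widetilde\varphi\circ j_X=\varphi$. For a right $(R,P_\Omega)$-module $(S,\mathfrak{s}_\Omega)$ and a left one $(M,\mathfrak{m}_\Omega)$, $S\otimes_{(R,P_\Omega)}M$ is the abelian group generated by symbols $s\otimes m$ ($s\in S,m\in M$) subject to additivity in each variable, $sr\otimes m=s\otimes rm$ and $\mathfrak{s}_\omega(s)\otimes m=s\otimes\mathfrak{m}_\omega(m)$ for all $r\in R,\omega\in\Omega$. A left $(R,P_\Omega)$-module $M$ is flat if the functor $-\otimes_{(R,P_\Omega)}M$ from right $(R,P_\Omega)$-modules to abelian groups is exact (takes short exact sequences to short exact sequences). *)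

theory Defs
  imports "HOL-Algebra.Module" "HOL-Algebra.Exact_Sequence" "HOL-Algebra.Free_Abelian_Groups"
begin

section \<open>Algebras and one-sided modules\<close>

text \<open>The locale \<^locale>\<open>algebra\<close> of the library is for commutative algebras only, and \<^locale>\<open>module\<close> is
  for modules over a commutative ring; here the algebra need not be commutative.\<close>

locale assoc_algebra = module K R + A?: ring R for K and R (structure) +
  assumes smult_mult_left:
      "\<lbrakk>c \<in> carrier K; x \<in> carrier R; y \<in> carrier R\<rbrakk>
        \<Longrightarrow> (c \<odot>\<^bsub>R\<^esub> x) \<otimes>\<^bsub>R\<^esub> y = c \<odot>\<^bsub>R\<^esub> (x \<otimes>\<^bsub>R\<^esub> y)"
    and smult_mult_right:
      "\<lbrakk>c \<in> carrier K; x \<in> carrier R; y \<in> carrier R\<rbrakk>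
        \<Longrightarrow> x \<otimes>\<^bsub>R\<^esub> (c \<odot>\<^bsub>R\<^esub> y) = c \<odot>\<^bsub>R\<^esub> (x \<otimes>\<^bsub>R\<^esub> y)"

locale left_module = R?: ring R + M?: abelian_group M
  for R :: "('r, 'a) ring_scheme" and M :: "('r, 'm, 'b) module_scheme" (structure) +
  assumes lact_closed: "\<lbrakk>r \<in> carrier R; m \<in> carrier M\<rbrakk> \<Longrightarrow> r \<odot>\<^bsub>M\<^esub> m \<in> carrier M"
    and lact_l_distr: "\<lbrakk>r \<in> carrier R; r' \<in> carrier R; m \<in> carrier M\<rbrakk>
      \<Longrightarrow> (r \<oplus>\<^bsub>R\<^esub> r') \<odot>\<^bsub>M\<^esub> m = r \<odot>\<^bsub>M\<^esub> m \<oplus>\<^bsub>M\<^esub> r' \<odot>\<^bsub>M\<^esub> m"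
    and lact_r_distr: "\<lbrakk>r \<in> carrier R; m \<in> carrier M; m' \<in> carrier M\<rbrakk>
      \<Longrightarrow> r \<odot>\<^bsub>M\<^esub> (m \<oplus>\<^bsub>M\<^esub> m') = r \<odot>\<^bsub>M\<^esub> m \<oplus>\<^bsub>M\<^esub> r \<odot>\<^bsub>M\<^esub> m'"
    and lact_assoc: "\<lbrakk>r \<in> carrier R; r' \<in> carrier R; m \<in> carrier M\<rbrakk>
      \<Longrightarrow> (r \<otimes>\<^bsub>R\<^esub> r') \<odot>\<^bsub>M\<^esub> m = r \<odot>\<^bsub>M\<^esub> (r' \<odot>\<^bsub>M\<^esub> m)"
    and lact_one: "m \<in> carrier M \<Longrightarrow> \<one>\<^bsub>R\<^esub> \<odot>\<^bsub>M\<^esub> m = m"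

text \<open>As in \<^theory>\<open>HOL-Algebra.Module\<close>, module records extend the ring record; the inherited ring
  multiplication and unit are never referred to. The last field of each record is the family of
  operators.\<close>

record ('r, 'w, 'm) left_op_module = "('r, 'm) module" +
  lop :: "'w \<Rightarrow> 'm \<Rightarrow> 'm"

record ('r, 'w, 's) right_op_module = "'s ring" +
  ract :: "['s, 'r] \<Rightarrow> 's" (infixl \<open>\<triangleleft>\<index>\<close> 70)
  rop :: "'w \<Rightarrow> 's \<Rightarrow> 's"

locale right_module = R?: ring R + S?: abelian_group S
  for R :: "('r, 'a) ring_scheme" and S :: "('r, 'w, 's, 'b) right_op_module_scheme" (structure) +
  assumes ract_closed: "\<lbrakk>s \<in> carrier S; r \<in> carrier R\<rbrakk> \<Longrightarrow> s \<triangleleft>\<^bsub>S\<^esub> r \<in> carrier S"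
    and ract_l_distr: "\<lbrakk>s \<in> carrier S; s' \<in> carrier S; r \<in> carrier R\<rbrakk>
      \<Longrightarrow> (s \<oplus>\<^bsub>S\<^esub> s') \<triangleleft>\<^bsub>S\<^esub> r = s \<triangleleft>\<^bsub>S\<^esub> r \<oplus>\<^bsub>S\<^esub> s' \<triangleleft>\<^bsub>S\<^esub> r"
    and ract_r_distr: "\<lbrakk>s \<in> carrier S; r \<in> carrier R; r' \<in> carrier R\<rbrakk>
      \<Longrightarrow> s \<triangleleft>\<^bsub>S\<^esub> (r \<oplus>\<^bsub>R\<^esub> r') = s \<triangleleft>\<^bsub>S\<^esub> r \<oplus>\<^bsub>S\<^esub> s \<triangleleft>\<^bsub>S\<^esub> r'"
    and ract_assoc: "\<lbrakk>s \<in> carrier S; r \<in> carrier R; r' \<in> carrier R\<rbrakk>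
      \<Longrightarrow> s \<triangleleft>\<^bsub>S\<^esub> (r \<otimes>\<^bsub>R\<^esub> r') = (s \<triangleleft>\<^bsub>S\<^esub> r) \<triangleleft>\<^bsub>S\<^esub> r'"
    and ract_one: "s \<in> carrier S \<Longrightarrow> s \<triangleleft>\<^bsub>S\<^esub> \<one>\<^bsub>R\<^esub> = s"

text \<open>The action of the ground ring \<open>K\<close> on a unital one-sided module over a \<open>K\<close>-algebra \<open>R\<close> is the
  restriction of the \<open>R\<close>-action along \<open>c \<mapsto> c 1\<^sub>R\<close>.\<close>

definition lscal :: "('k, 'r, 'a) module_scheme \<Rightarrow> ('r, 'm, 'b) module_scheme \<Rightarrow> 'k \<Rightarrow> 'm \<Rightarrow> 'm"
  where "lscal R M c m = (c \<odot>\<^bsub>R\<^esub> \<one>\<^bsub>R\<^esub>) \<odot>\<^bsub>M\<^esub> m"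

definition rscal :: "('k, 'r, 'a) module_scheme \<Rightarrow> ('r, 'w, 's, 'b) right_op_module_scheme \<Rightarrow> 'k \<Rightarrow> 's \<Rightarrow> 's"
  where "rscal R S c s = s \<triangleleft>\<^bsub>S\<^esub> (c \<odot>\<^bsub>R\<^esub> \<one>\<^bsub>R\<^esub>)"

definition linear_operator ::
    "('k, 'a) ring_scheme \<Rightarrow> ('v, 'b) ring_scheme \<Rightarrow> ('k \<Rightarrow> 'v \<Rightarrow> 'v) \<Rightarrow> ('v \<Rightarrow> 'v) \<Rightarrow> bool"
  where "linear_operator K V scal f \<longleftrightarrow>
    f \<in> hom (add_monoid V) (add_monoid V) \<and>
    (\<forall>c\<in>carrier K. \<forall>v\<in>carrier V. f (scal c v) = scal c (f v))"


section \<open>Multiple Rota-Baxter algebras of pair weight \<open>(\<lambda>\<^sub>\<Omega>, \<lambda>\<^sub>\<Omega>)\<close> and their modules\<close>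

locale multiple_rota_baxter_algebra = assoc_algebra K R
  for K :: "('k, 'a) ring_scheme" and R :: "('k, 'r, 'b) module_scheme" (structure) +
  fixes Omega :: "'w set" and lam :: "'w \<Rightarrow> 'k" and P :: "'w \<Rightarrow> 'r \<Rightarrow> 'r"
  assumes Omega_nonempty: "Omega \<noteq> {}"
    and lam_closed: "\<omega> \<in> Omega \<Longrightarrow> lam \<omega> \<in> carrier K"
    and P_linear: "\<omega> \<in> Omega \<Longrightarrow> linear_operator K R (smult R) (P \<omega>)"
    and rota_baxter: "\<lbrakk>\<alpha> \<in> Omega; \<beta> \<in> Omega; r \<in> carrier R; s \<in> carrier R\<rbrakk> \<Longrightarrow>
      P \<alpha> r \<otimes>\<^bsub>R\<^esub> P \<beta> s =
        P \<alpha> (r \<otimes>\<^bsub>R\<^esub> P \<beta> s) \<oplus>\<^bsub>R\<^esub> P \<beta> (P \<alpha> r \<otimes>\<^bsub>R\<^esub> s)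
        \<oplus>\<^bsub>R\<^esub> lam \<beta> \<odot>\<^bsub>R\<^esub> P \<alpha> (r \<otimes>\<^bsub>R\<^esub> s) \<oplus>\<^bsub>R\<^esub> lam \<alpha> \<odot>\<^bsub>R\<^esub> P \<beta> (r \<otimes>\<^bsub>R\<^esub> s)"

locale left_rb_module =
  multiple_rota_baxter_algebra K R Omega lam P + L?: left_module R M
  for K :: "('k, 'a) ring_scheme" and R :: "('k, 'r, 'b) module_scheme" (structure)
    and Omega :: "'w set" and lam and P
    and M :: "('r, 'w, 'm, 'c) left_op_module_scheme" (structure) +
  assumes lop_linear: "\<omega> \<in> Omega \<Longrightarrow> linear_operator K M (lscal R M) (lop M \<omega>)"
    and left_rota_baxter: "\<lbrakk>\<alpha> \<in> Omega; \<beta> \<in> Omega; r \<in> carrier R; m \<in> carrier M\<rbrakk> \<Longrightarrow>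
      P \<alpha> r \<odot>\<^bsub>M\<^esub> lop M \<beta> m =
        lop M \<alpha> (r \<odot>\<^bsub>M\<^esub> lop M \<beta> m) \<oplus>\<^bsub>M\<^esub> lop M \<beta> (P \<alpha> r \<odot>\<^bsub>M\<^esub> m)
        \<oplus>\<^bsub>M\<^esub> lscal R M (lam \<beta>) (lop M \<alpha> (r \<odot>\<^bsub>M\<^esub> m))
        \<oplus>\<^bsub>M\<^esub> lscal R M (lam \<alpha>) (lop M \<beta> (r \<odot>\<^bsub>M\<^esub> m))"

locale right_rb_module =
  multiple_rota_baxter_algebra K R Omega lam P + N?: right_module R S
  for K :: "('k, 'a) ring_scheme" and R :: "('k, 'r, 'b) module_scheme" (structure)
    and Omega :: "'w set" and lam and P
    and S :: "('r, 'w, 's, 'c) right_op_module_scheme" (structure) +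
  assumes rop_linear: "\<omega> \<in> Omega \<Longrightarrow> linear_operator K S (rscal R S) (rop S \<omega>)"
    and right_rota_baxter: "\<lbrakk>\<alpha> \<in> Omega; \<beta> \<in> Omega; r \<in> carrier R; s \<in> carrier S\<rbrakk> \<Longrightarrow>
      rop S \<beta> (s \<triangleleft>\<^bsub>S\<^esub> P \<alpha> r) =
        rop S \<beta> (rop S \<alpha> s \<triangleleft>\<^bsub>S\<^esub> r) \<oplus>\<^bsub>S\<^esub> rop S \<beta> s \<triangleleft>\<^bsub>S\<^esub> P \<alpha> r
        \<oplus>\<^bsub>S\<^esub> rscal R S (lam \<beta>) (rop S \<alpha> s \<triangleleft>\<^bsub>S\<^esub> r)
        \<oplus>\<^bsub>S\<^esub> rscal R S (lam \<alpha>) (rop S \<beta> s \<triangleleft>\<^bsub>S\<^esub> r)"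

definition left_rb_hom ::
    "('r, 'a) ring_scheme \<Rightarrow> 'w set \<Rightarrow> ('r, 'w, 'm, 'b) left_op_module_scheme \<Rightarrow>
      ('r, 'w, 'n, 'c) left_op_module_scheme \<Rightarrow> ('m \<Rightarrow> 'n) set"
  where "left_rb_hom R Omega M N =
    {h \<in> hom (add_monoid M) (add_monoid N).
      (\<forall>r\<in>carrier R. \<forall>m\<in>carrier M. h (r \<odot>\<^bsub>M\<^esub> m) = r \<odot>\<^bsub>N\<^esub> h m) \<and>
      (\<forall>\<omega>\<in>Omega. \<forall>m\<in>carrier M. h (lop M \<omega> m) = lop N \<omega> (h m))}"

definition right_rb_hom ::
    "('r, 'a) ring_scheme \<Rightarrow> 'w set \<Rightarrow> ('r, 'w, 's, 'b) right_op_module_scheme \<Rightarrow>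
      ('r, 'w, 't, 'c) right_op_module_scheme \<Rightarrow> ('s \<Rightarrow> 't) set"
  where "right_rb_hom R Omega S T =
    {h \<in> hom (add_monoid S) (add_monoid T).
      (\<forall>r\<in>carrier R. \<forall>s\<in>carrier S. h (s \<triangleleft>\<^bsub>S\<^esub> r) = h s \<triangleleft>\<^bsub>T\<^esub> r) \<and>
      (\<forall>\<omega>\<in>Omega. \<forall>s\<in>carrier S. h (rop S \<omega> s) = rop T \<omega> (h s))}"


section \<open>Free modules\<close>

text \<open>The universal property, tested against the modules \<open>M\<close> whose carrier is a set of elements of the
  type \<open>'u\<close>. Functions are total in HOL, so uniqueness is equality on the carrier of \<open>F\<close>.\<close>

definition free_left_rb_module ::
    "'u itself \<Rightarrow> ('k, 'a) ring_scheme \<Rightarrow> ('k, 'r, 'b) module_scheme \<Rightarrow> 'w set \<Rightarrow> ('w \<Rightarrow> 'k) \<Rightarrow>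
      ('w \<Rightarrow> 'r \<Rightarrow> 'r) \<Rightarrow> 'x set \<Rightarrow> ('r, 'w, 'f, 'c) left_op_module_scheme \<Rightarrow> ('x \<Rightarrow> 'f) \<Rightarrow> bool"
  where "free_left_rb_module (u :: 'u itself) K R Omega lam P basis F j \<longleftrightarrow>
    left_rb_module K R Omega lam P F \<and> j \<in> basis \<rightarrow> carrier F \<and>
    (\<forall>(M :: ('r, 'w, 'u) left_op_module) phi.
      left_rb_module K R Omega lam P M \<and> phi \<in> basis \<rightarrow> carrier M \<longrightarrow>
      (\<exists>h\<in>left_rb_hom R Omega F M. \<forall>x\<in>basis. h (j x) = phi x) \<and>
      (\<forall>h\<in>left_rb_hom R Omega F M. \<forall>h'\<in>left_rb_hom R Omega F M.
        (\<forall>x\<in>basis. h (j x) = phi x) \<and> (\<forall>x\<in>basis. h' (j x) = phi x) \<longrightarrow>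
        (\<forall>y\<in>carrier F. h y = h' y)))"

text \<open>HOL cannot quantify over all types inside a hypothesis, so one test type has to be chosen. A sum
  \<open>('r, 'w, 'x) module_term set + 'f\<close> is large enough: the free module on \<open>basis\<close> can be realised as
  a set of equivalence classes of formal expressions in the generators, hence on a subset of the
  left summand, and the right summand accommodates \<open>F\<close> itself. Comparing the two shows that \<open>F\<close> then
  has the universal property for test modules over every type. Testing against fewer modules
  only weakens the hypothesis that a module is free.\<close>

datatype ('r, 'w, 'x) module_term =
    Gen 'x
  | Zero
  | Neg "('r, 'w, 'x) module_term"
  | Plus "('r, 'w, 'x) module_term" "('r, 'w, 'x) module_term"
  | Act 'r "('r, 'w, 'x) module_term"
  | Oper 'w "('r, 'w, 'x) module_term"

type_synonym ('r, 'w, 'x, 'f) test_universe = "('r, 'w, 'x) module_term set + 'f"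


section \<open>Tensor product and flatness\<close>

definition tensor_relations ::
    "('r, 'a) ring_scheme \<Rightarrow> 'w set \<Rightarrow> ('r, 'w, 's, 'b) right_op_module_scheme \<Rightarrow>
      ('r, 'w, 'm, 'c) left_op_module_scheme \<Rightarrow> ('s \<times> 'm \<Rightarrow>\<^sub>0 int) set"
  where "tensor_relations R Omega S M =
      {frag_of (s \<oplus>\<^bsub>S\<^esub> s', m) - frag_of (s, m) - frag_of (s', m) | s s' m.
        s \<in> carrier S \<and> s' \<in> carrier S \<and> m \<in> carrier M}
    \<union> {frag_of (s, m \<oplus>\<^bsub>M\<^esub> m') - frag_of (s, m) - frag_of (s, m') | s m m'.
        s \<in> carrier S \<and> m \<in> carrier M \<and> m' \<in> carrier M}
    \<union> {frag_of (s \<triangleleft>\<^bsub>S\<^esub> r, m) - frag_of (s, r \<odot>\<^bsub>M\<^esub> m) | s r m.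
        s \<in> carrier S \<and> r \<in> carrier R \<and> m \<in> carrier M}
    \<union> {frag_of (rop S \<omega> s, m) - frag_of (s, lop M \<omega> m) | s \<omega> m.
        s \<in> carrier S \<and> \<omega> \<in> Omega \<and> m \<in> carrier M}"

definition tensor_kernel ::
    "('r, 'a) ring_scheme \<Rightarrow> 'w set \<Rightarrow> ('r, 'w, 's, 'b) right_op_module_scheme \<Rightarrow>
      ('r, 'w, 'm, 'c) left_op_module_scheme \<Rightarrow> ('s \<times> 'm \<Rightarrow>\<^sub>0 int) set"
  where "tensor_kernel R Omega S M =
    generate (free_Abelian_group (carrier S \<times> carrier M)) (tensor_relations R Omega S M)"

text \<open>The group operation of \<^const>\<open>free_Abelian_group\<close> is addition, but it is a \<^typ>\<open>'a monoid\<close>, so the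
  tensor product is a multiplicatively written abelian group.\<close>

definition tensor_product ::
    "('r, 'a) ring_scheme \<Rightarrow> 'w set \<Rightarrow> ('r, 'w, 's, 'b) right_op_module_scheme \<Rightarrow>
      ('r, 'w, 'm, 'c) left_op_module_scheme \<Rightarrow> ('s \<times> 'm \<Rightarrow>\<^sub>0 int) set monoid"
  where "tensor_product R Omega S M =
    free_Abelian_group (carrier S \<times> carrier M) Mod tensor_kernel R Omega S M"

text \<open>The functor on morphisms: for \<open>f : S \<rightarrow> T\<close>, the map \<open>f \<otimes> id\<close> sends the class of
  \<open>\<Sum>\<^sub>i n\<^sub>i (s\<^sub>i, m\<^sub>i)\<close> to the class of \<open>\<Sum>\<^sub>i n\<^sub>i (f s\<^sub>i, m\<^sub>i)\<close>.\<close>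

definition tensor_map ::
    "('r, 'a) ring_scheme \<Rightarrow> 'w set \<Rightarrow> ('r, 'w, 't, 'b) right_op_module_scheme \<Rightarrow>
      ('r, 'w, 'm, 'c) left_op_module_scheme \<Rightarrow> ('s \<Rightarrow> 't) \<Rightarrow>
      ('s \<times> 'm \<Rightarrow>\<^sub>0 int) set \<Rightarrow> ('t \<times> 'm \<Rightarrow>\<^sub>0 int) set"
  where "tensor_map R Omega T M f C =
    the_elem ((\<lambda>z. tensor_kernel R Omega T M
                 #>\<^bsub>free_Abelian_group (carrier T \<times> carrier M)\<^esub>
                 frag_extend (\<lambda>(s, m). frag_of (f s, m)) z) ` C)"

text \<open>\<open>0 \<rightarrow> A \<rightarrow> B \<rightarrow> C \<rightarrow> 0\<close>; the library's \<^const>\<open>short_exact_sequence\<close> requires the three groups to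
  have the same element type.\<close>

definition short_exact ::
    "('a, 'i) monoid_scheme \<Rightarrow> ('b, 'j) monoid_scheme \<Rightarrow> ('c, 'l) monoid_scheme \<Rightarrow>
      ('a \<Rightarrow> 'b) \<Rightarrow> ('b \<Rightarrow> 'c) \<Rightarrow> bool"
  where "short_exact A B C f g \<longleftrightarrow>
    group A \<and> group B \<and> group C \<and> f \<in> mon A B \<and> g \<in> epi B C \<and> f ` carrier A = kernel B C g"

text \<open>Exactness of \<open>- \<otimes> M\<close> on the short exact sequences of right modules over the element types
  \<open>'a\<close>, \<open>'b\<close>, \<open>'c\<close>. Proving this for type variables covers all right modules.\<close>

definition flat_left_rb_module ::
    "'a itself \<Rightarrow> 'b itself \<Rightarrow> 'c itself \<Rightarrow> ('k, 'i) ring_scheme \<Rightarrow> ('k, 'r, 'j) module_scheme \<Rightarrow>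
      'w set \<Rightarrow> ('w \<Rightarrow> 'k) \<Rightarrow> ('w \<Rightarrow> 'r \<Rightarrow> 'r) \<Rightarrow> ('r, 'w, 'm, 'l) left_op_module_scheme \<Rightarrow> bool"
  where "flat_left_rb_module (ta :: 'a itself) (tb :: 'b itself) (tc :: 'c itself) K R Omega lam P M \<longleftrightarrow>
    left_rb_module K R Omega lam P M \<and>
    (\<forall>(A :: ('r, 'w, 'a) right_op_module) (B :: ('r, 'w, 'b) right_op_module)
       (C :: ('r, 'w, 'c) right_op_module) f g.
      right_rb_module K R Omega lam P A \<and> right_rb_module K R Omega lam P B \<and>
      right_rb_module K R Omega lam P C \<and>
      f \<in> right_rb_hom R Omega A B \<and> g \<in> right_rb_hom R Omega B C \<and>
      short_exact (add_monoid A) (add_monoid B) (add_monoid C) f g \<longrightarrow>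
      short_exact (tensor_product R Omega A M) (tensor_product R Omega B M)
        (tensor_product R Omega C M) (tensor_map R Omega B M f) (tensor_map R Omega C M g))"

end

theory Submission
  imports Defs
begin

text \<open>
  For a free left module \<open>F\<close> with generators \<open>j x\<close> and a right module \<open>S\<close>, the tensor product
  \<open>S \<otimes> F\<close> is the direct sum of copies of \<open>S\<close>, one for each generator, naturally in \<open>S\<close>. Direct sums of
  short exact sequences are exact, so \<open>F\<close> is flat. The direct sum is not constructed; instead every
  element of \<open>S \<otimes> F\<close> is shown to have a normal form \<open>\<Sum>\<^sub>x u x \<otimes> j x\<close> with finitely many coefficients
  \<open>u x\<close> in \<open>S\<close> (\<open>normal_form\<close>), which represents zero only if all coefficients vanish
  (\<open>basis_sum_in_relators_iff\<close>). A homomorphism of right modules acts on the coefficients, and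
  exactness can be read off from them (\<open>free_left_rb_module_tensor_short_exact\<close>).

  Existence of normal forms holds because \<open>F\<close> is generated by the elements \<open>j x\<close>
  (\<open>free_left_rb_module_generated\<close>). For uniqueness one needs coordinate maps \<open>S \<otimes> F \<rightarrow> S\<close>. They come
  from the adjunction between the tensor product and additive maps: \<open>Hom\<^sub>\<int>(S, G)\<close> is a left module
  (\<open>hom_module_is_left_rb_module\<close>), the homomorphisms from \<open>F\<close> to it are the additive maps from
  \<open>S \<otimes> F\<close> to \<open>G\<close>, and freeness allows their values on the generators to be prescribed
  (\<open>tensor_free_universal\<close>).

  The type of \<open>Hom\<^sub>\<int>(S, G)\<close> is unrelated to the type over which freeness is tested. The bridge is
  that the submodule generated by the images of the generators embeds into the sets of formal terms
  (\<open>free_left_rb_module_extension\<close>).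
\<close>


section \<open>Generated submodules and transport of structure\<close>

inductive_set generated_submodule ::
    "('r, 'a) ring_scheme \<Rightarrow> 'w set \<Rightarrow> ('r, 'w, 'm, 'b) left_op_module_scheme \<Rightarrow> 'm set \<Rightarrow> 'm set"
  for R and Omega and M (structure) and Y where
    gen: "y \<in> Y \<Longrightarrow> y \<in> generated_submodule R Omega M Y"
  | zero: "\<zero> \<in> generated_submodule R Omega M Y"
  | neg: "m \<in> generated_submodule R Omega M Y \<Longrightarrow> \<ominus> m \<in> generated_submodule R Omega M Y"
  | add: "\<lbrakk>m \<in> generated_submodule R Omega M Y; n \<in> generated_submodule R Omega M Y\<rbrakk>
      \<Longrightarrow> m \<oplus> n \<in> generated_submodule R Omega M Y"
  | act: "\<lbrakk>r \<in> carrier R; m \<in> generated_submodule R Omega M Y\<rbrakk>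
      \<Longrightarrow> r \<odot>\<^bsub>M\<^esub> m \<in> generated_submodule R Omega M Y"
  | oper: "\<lbrakk>\<omega> \<in> Omega; m \<in> generated_submodule R Omega M Y\<rbrakk>
      \<Longrightarrow> lop M \<omega> m \<in> generated_submodule R Omega M Y"

primrec eval_term ::
    "('r, 'w, 'm, 'b) left_op_module_scheme \<Rightarrow> ('x \<Rightarrow> 'm) \<Rightarrow> ('r, 'w, 'x) module_term \<Rightarrow> 'm" where
    "eval_term M phi (Gen x) = phi x"
  | "eval_term M phi Zero = \<zero>\<^bsub>M\<^esub>"
  | "eval_term M phi (Neg t) = \<ominus>\<^bsub>M\<^esub> eval_term M phi t"
  | "eval_term M phi (Plus t t') = eval_term M phi t \<oplus>\<^bsub>M\<^esub> eval_term M phi t'"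
  | "eval_term M phi (Act r t) = r \<odot>\<^bsub>M\<^esub> eval_term M phi t"
  | "eval_term M phi (Oper \<omega> t) = lop M \<omega> (eval_term M phi t)"

text \<open>An element of the submodule generated by the values of \<open>phi\<close> is the value of a formal term, so
  it is determined by the set of all terms with that value. This makes the generated submodule, over
  whatever type it lives, embeddable into sets of terms.\<close>

lemma generated_submodule_subset_eval_term:
  "generated_submodule R Omega M (phi ` X) \<subseteq> range (eval_term M phi)"
proof
  fix m assume "m \<in> generated_submodule R Omega M (phi ` X)"
  then show "m \<in> range (eval_term M phi)"
  proof induction
    case (gen y)
    then obtain x where "y = eval_term M phi (Gen x)" by auto
    then show ?case by blast
  next
    case zero
    have "\<zero>\<^bsub>M\<^esub> = eval_term M phi Zero" by simp
    then show ?case by blast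
  next
    case (neg m)
    then obtain t where "\<ominus>\<^bsub>M\<^esub> m = eval_term M phi (Neg t)" by auto
    then show ?case by blast
  next
    case (add m n)
    then obtain t t' where "m \<oplus>\<^bsub>M\<^esub> n = eval_term M phi (Plus t t')" by auto
    then show ?case by blast
  next
    case (act r m)
    then obtain t where "r \<odot>\<^bsub>M\<^esub> m = eval_term M phi (Act r t)" by auto
    then show ?case by blast
  next
    case (oper \<omega> m)
    then obtain t where "lop M \<omega> m = eval_term M phi (Oper \<omega> t)" by auto
    then show ?case by blast
  qed
qed

lemma linear_operatorD:
  assumes "linear_operator K V scal f"
  shows "v \<in> carrier V \<Longrightarrow> f v \<in> carrier V"
    and "\<lbrakk>v \<in> carrier V; w \<in> carrier V\<rbrakk> \<Longrightarrow> f (v \<oplus>\<^bsub>V\<^esub> w) = f v \<oplus>\<^bsub>V\<^esub> f w"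
    and "\<lbrakk>c \<in> carrier K; v \<in> carrier V\<rbrakk> \<Longrightarrow> f (scal c v) = scal c (f v)"
  using assms by (auto simp: linear_operator_def hom_def)

lemma linear_operatorI:
  assumes "\<And>v. v \<in> carrier V \<Longrightarrow> f v \<in> carrier V"
    and "\<And>v w. \<lbrakk>v \<in> carrier V; w \<in> carrier V\<rbrakk> \<Longrightarrow> f (v \<oplus>\<^bsub>V\<^esub> w) = f v \<oplus>\<^bsub>V\<^esub> f w"
    and "\<And>c v. \<lbrakk>c \<in> carrier K; v \<in> carrier V\<rbrakk> \<Longrightarrow> f (scal c v) = scal c (f v)"
  shows "linear_operator K V scal f"
  using assms by (auto simp: linear_operator_def hom_def)

lemma add_monoid_homD:
  assumes "h \<in> hom (add_monoid M) (add_monoid N)"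
  shows "x \<in> carrier M \<Longrightarrow> h x \<in> carrier N"
    and "\<lbrakk>x \<in> carrier M; y \<in> carrier M\<rbrakk> \<Longrightarrow> h (x \<oplus>\<^bsub>M\<^esub> y) = h x \<oplus>\<^bsub>N\<^esub> h y"
  using assms by (auto simp: hom_def)

lemma add_monoid_hom_zero:
  assumes "abelian_group M" "abelian_group N" "h \<in> hom (add_monoid M) (add_monoid N)"
  shows "h \<zero>\<^bsub>M\<^esub> = \<zero>\<^bsub>N\<^esub>"
proof -
  interpret H: group_hom "add_monoid M" "add_monoid N" h
    using assms by (simp add: group_hom_def group_hom_axioms_def abelian_group.a_group)
  show ?thesis using H.hom_one by simp
qed

lemma left_rb_homI:
  assumes "\<And>m. m \<in> carrier M \<Longrightarrow> h m \<in> carrier N"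
    and "\<And>m m'. \<lbrakk>m \<in> carrier M; m' \<in> carrier M\<rbrakk> \<Longrightarrow> h (m \<oplus>\<^bsub>M\<^esub> m') = h m \<oplus>\<^bsub>N\<^esub> h m'"
    and "\<And>r m. \<lbrakk>r \<in> carrier R; m \<in> carrier M\<rbrakk> \<Longrightarrow> h (r \<odot>\<^bsub>M\<^esub> m) = r \<odot>\<^bsub>N\<^esub> h m"
    and "\<And>\<omega> m. \<lbrakk>\<omega> \<in> Omega; m \<in> carrier M\<rbrakk> \<Longrightarrow> h (lop M \<omega> m) = lop N \<omega> (h m)"
  shows "h \<in> left_rb_hom R Omega M N"
  using assms by (auto simp: left_rb_hom_def hom_def)

lemma left_rb_homD:
  assumes "h \<in> left_rb_hom R Omega M N"
  shows "m \<in> carrier M \<Longrightarrow> h m \<in> carrier N"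
    and "\<lbrakk>m \<in> carrier M; m' \<in> carrier M\<rbrakk> \<Longrightarrow> h (m \<oplus>\<^bsub>M\<^esub> m') = h m \<oplus>\<^bsub>N\<^esub> h m'"
    and "\<lbrakk>r \<in> carrier R; m \<in> carrier M\<rbrakk> \<Longrightarrow> h (r \<odot>\<^bsub>M\<^esub> m) = r \<odot>\<^bsub>N\<^esub> h m"
    and "\<lbrakk>\<omega> \<in> Omega; m \<in> carrier M\<rbrakk> \<Longrightarrow> h (lop M \<omega> m) = lop N \<omega> (h m)"
  using assms by (auto simp: left_rb_hom_def hom_def)

lemma left_rb_hom_compose:
  assumes "h \<in> left_rb_hom R Omega L M" "h' \<in> left_rb_hom R Omega M N"
  shows "h' \<circ> h \<in> left_rb_hom R Omega L N"
  using left_rb_homD[OF assms(1)] left_rb_homD[OF assms(2)]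
  by (intro left_rb_homI) (simp_all)

text \<open>For a submodule \<open>N\<close> of \<open>M\<close> and a map \<open>e\<close> that is injective on \<open>N\<close>, this is an isomorphic copy of
  \<open>N\<close> over the target type of \<open>e\<close>.\<close>

definition transported_module ::
    "('m \<Rightarrow> 'n) \<Rightarrow> 'm set \<Rightarrow> ('r, 'w, 'm, 'b) left_op_module_scheme \<Rightarrow> ('r, 'w, 'n) left_op_module"
  where "transported_module e N M =
    \<lparr>carrier = e ` N, mult = undefined, one = undefined, ring.zero = e \<zero>\<^bsub>M\<^esub>,
     ring.add = (\<lambda>a b. e (inv_into N e a \<oplus>\<^bsub>M\<^esub> inv_into N e b)),
     smult = (\<lambda>r a. e (r \<odot>\<^bsub>M\<^esub> inv_into N e a)),
     lop = (\<lambda>\<omega> a. e (lop M \<omega> (inv_into N e a)))\<rparr>"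

locale rb_submodule = left_rb_module K R Omega lam P M
  for K :: "('k, 'a) ring_scheme" and R :: "('k, 'r, 'b) module_scheme"
    and Omega :: "'w set" and lam and P
    and M :: "('r, 'w, 'm, 'c) left_op_module_scheme" +
  fixes N :: "'m set"
  assumes subset: "N \<subseteq> carrier M"
    and zero_in: "\<zero>\<^bsub>M\<^esub> \<in> N"
    and neg_in: "n \<in> N \<Longrightarrow> \<ominus>\<^bsub>M\<^esub> n \<in> N"
    and add_in: "\<lbrakk>n \<in> N; n' \<in> N\<rbrakk> \<Longrightarrow> n \<oplus>\<^bsub>M\<^esub> n' \<in> N"
    and act_in: "\<lbrakk>r \<in> carrier R; n \<in> N\<rbrakk> \<Longrightarrow> r \<odot>\<^bsub>M\<^esub> n \<in> N"
    and oper_in: "\<lbrakk>\<omega> \<in> Omega; n \<in> N\<rbrakk> \<Longrightarrow> lop M \<omega> n \<in> N"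
begin

lemma transported_module_is_left_rb_module:
  assumes inj: "inj_on e N"
  shows "left_rb_module K R Omega lam P (transported_module e N M)" (is "left_rb_module K R Omega lam P ?T")
proof -
  have T [simp]: "carrier ?T = e ` N" "\<zero>\<^bsub>?T\<^esub> = e \<zero>\<^bsub>M\<^esub>"
    "\<And>a b. \<lbrakk>a \<in> N; b \<in> N\<rbrakk> \<Longrightarrow> e a \<oplus>\<^bsub>?T\<^esub> e b = e (a \<oplus>\<^bsub>M\<^esub> b)"
    "\<And>r a. a \<in> N \<Longrightarrow> r \<odot>\<^bsub>?T\<^esub> e a = e (r \<odot>\<^bsub>M\<^esub> a)"
    "\<And>\<omega> a. a \<in> N \<Longrightarrow> lop ?T \<omega> (e a) = e (lop M \<omega> a)"
    using inj by (simp_all add: transported_module_def)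
  have sub [simp]: "n \<in> N \<Longrightarrow> n \<in> carrier M" for n using subset by blast
  note [simp] = zero_in neg_in add_in act_in oper_in
  have lsc: "\<And>c a. a \<in> N \<Longrightarrow> lscal R ?T c (e a) = e (lscal R M c a)"
    by (simp add: lscal_def)
  have lin: "\<And>c a. \<lbrakk>c \<in> carrier K; a \<in> N\<rbrakk> \<Longrightarrow> lscal R M c a \<in> N"
    by (simp add: lscal_def)
  have "abelian_group ?T"
  proof (rule abelian_groupI)
    fix x assume "x \<in> carrier ?T"
    then obtain a where a: "a \<in> N" "x = e a" by auto
    then have "e (\<ominus>\<^bsub>M\<^esub> a) \<oplus>\<^bsub>?T\<^esub> x = \<zero>\<^bsub>?T\<^esub>" by (simp add: L.M.l_neg)
    then show "\<exists>y\<in>carrier ?T. y \<oplus>\<^bsub>?T\<^esub> x = \<zero>\<^bsub>?T\<^esub>" using a by auto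
  qed (auto simp: L.M.a_ac)
  then interpret T: abelian_group ?T .
  have "left_module R ?T"
    by unfold_locales
      (auto simp: lact_l_distr lact_r_distr lact_assoc lact_one)
  then interpret TL: left_module R ?T .
  show ?thesis
  proof unfold_locales
    fix w assume w: "w \<in> Omega"
    show "linear_operator K ?T (lscal R ?T) (lop ?T w)"
      by (rule linear_operatorI)
        (use w linear_operatorD[OF lop_linear[OF w]] in \<open>auto simp: lsc lin\<close>)
  next
    fix w v r m assume *: "w \<in> Omega" "v \<in> Omega" "r \<in> carrier R" "m \<in> carrier ?T"
    then obtain a where a: "a \<in> N" "m = e a" by auto
    have P: "P w r \<in> carrier R"
      using linear_operatorD(1)[OF P_linear] * by simp
    show "P w r \<odot>\<^bsub>?T\<^esub> lop ?T v m =
        lop ?T w (r \<odot>\<^bsub>?T\<^esub> lop ?T v m) \<oplus>\<^bsub>?T\<^esub> lop ?T v (P w r \<odot>\<^bsub>?T\<^esub> m)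
        \<oplus>\<^bsub>?T\<^esub> lscal R ?T (lam v) (lop ?T w (r \<odot>\<^bsub>?T\<^esub> m))
        \<oplus>\<^bsub>?T\<^esub> lscal R ?T (lam w) (lop ?T v (r \<odot>\<^bsub>?T\<^esub> m))"
      using * a P by (simp add: lsc lin lam_closed left_rota_baxter)
  qed
qed

lemma inv_into_transported_hom:
  assumes "inj_on e N"
  shows "inv_into N e \<in> left_rb_hom R Omega (transported_module e N M) M"
  using assms subset
  by (intro left_rb_homI)
    (auto simp: transported_module_def add_in act_in oper_in)

lemma transport_hom:
  assumes "inj_on e N" "h \<in> left_rb_hom R Omega L M" "h ` carrier L \<subseteq> N"
  shows "e \<circ> h \<in> left_rb_hom R Omega L (transported_module e N M)"
proof -
  have "h m \<in> N" if "m \<in> carrier L" for m using assms(3) that by blast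
  then show ?thesis
    using assms(1) left_rb_homD[OF assms(2)]
    by (intro left_rb_homI) (auto simp: transported_module_def)
qed

end

lemma (in left_rb_module) generated_submodule_rb_submodule:
  assumes "Y \<subseteq> carrier M"
  shows "rb_submodule K R Omega lam P M (generated_submodule R Omega M Y)"
proof unfold_locales
  show "generated_submodule R Omega M Y \<subseteq> carrier M"
  proof
    fix m assume "m \<in> generated_submodule R Omega M Y"
    then show "m \<in> carrier M"
      by induction (use assms linear_operatorD(1)[OF lop_linear] lact_closed in auto)
  qed
qed (auto intro: generated_submodule.intros)

lemma (in left_rb_module) carrier_rb_submodule: "rb_submodule K R Omega lam P M (carrier M)"
  by unfold_locales (use linear_operatorD(1)[OF lop_linear] lact_closed in auto)


section \<open>Free modules: universal property over every type, generation\<close>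

lemma free_left_rb_moduleD:
  fixes M :: "('r, 'w, 'u) left_op_module"
  assumes "free_left_rb_module TYPE('u) K R Omega lam P basis F j"
    and "left_rb_module K R Omega lam P M" "phi \<in> basis \<rightarrow> carrier M"
  shows "\<exists>h\<in>left_rb_hom R Omega F M. \<forall>x\<in>basis. h (j x) = phi x"
    and "\<lbrakk>h \<in> left_rb_hom R Omega F M; h' \<in> left_rb_hom R Omega F M;
        \<forall>x\<in>basis. h (j x) = phi x; \<forall>x\<in>basis. h' (j x) = phi x; y \<in> carrier F\<rbrakk> \<Longrightarrow> h y = h' y"
  using assms unfolding free_left_rb_module_def by blast+

text \<open>The hypothesis of freeness speaks of test modules over one type only. Here \<open>M\<close> lives over an
  arbitrary type: replace \<open>M\<close> by its submodule generated by the values of \<open>phi\<close>, name every element of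
  that submodule by the set of terms with this value, apply the universal property to this copy, and
  translate back. The bound on the image is what shows later that \<open>F\<close> is generated by its basis.\<close>

lemma free_left_rb_module_extension:
  fixes F :: "('r, 'w, 'f, 'c) left_op_module_scheme" and basis :: "'x set"
    and M :: "('r, 'w, 'm, 'd) left_op_module_scheme"
  assumes F: "free_left_rb_module TYPE(('r, 'w, 'x, 'f) test_universe) K R Omega lam P basis F j"
    and M: "left_rb_module K R Omega lam P M" and phi: "phi \<in> basis \<rightarrow> carrier M"
  obtains h where "h \<in> left_rb_hom R Omega F M" "\<And>x. x \<in> basis \<Longrightarrow> h (j x) = phi x"
    "h ` carrier F \<subseteq> generated_submodule R Omega M (phi ` basis)"
proof -
  let ?N = "generated_submodule R Omega M (phi ` basis)"
  interpret M: left_rb_module K R Omega lam P M by (rule M)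
  interpret N: rb_submodule K R Omega lam P M ?N
    by (rule M.generated_submodule_rb_submodule) (use phi in auto)
  define e :: "'m \<Rightarrow> ('r, 'w, 'x, 'f) test_universe"
    where "e = (\<lambda>m. Inl {t. eval_term M phi t = m})"
  have inj: "inj_on e ?N"
  proof (rule inj_on_subset[OF _ generated_submodule_subset_eval_term])
    show "inj_on e (range (eval_term M phi))"
      by (rule inj_onI) (simp add: e_def, blast)
  qed
  let ?T = "transported_module e ?N M"
  have "left_rb_module K R Omega lam P ?T"
    by (rule N.transported_module_is_left_rb_module[OF inj])
  moreover have "e \<circ> phi \<in> basis \<rightarrow> carrier ?T"
    by (auto simp: transported_module_def intro!: imageI generated_submodule.gen)
  ultimately have "\<exists>h\<in>left_rb_hom R Omega F ?T. \<forall>x\<in>basis. h (j x) = (e \<circ> phi) x"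
    by (rule free_left_rb_moduleD(1)[OF F])
  then obtain h where h: "h \<in> left_rb_hom R Omega F ?T" "\<forall>x\<in>basis. h (j x) = (e \<circ> phi) x" ..
  show thesis
  proof
    show "inv_into ?N e \<circ> h \<in> left_rb_hom R Omega F M"
      by (rule left_rb_hom_compose[OF h(1) N.inv_into_transported_hom[OF inj]])
    show "(inv_into ?N e \<circ> h) (j x) = phi x" if "x \<in> basis" for x
      using h(2) inj that by (simp add: generated_submodule.gen)
    show "(inv_into ?N e \<circ> h) ` carrier F \<subseteq> ?N"
      using left_rb_homD(1)[OF h(1)] by (auto simp: transported_module_def intro: inv_into_into)
  qed
qed

text \<open>By the extension property there is an endomorphism \<open>p\<close> of \<open>F\<close> that fixes the generators and has
  its values in the submodule that they generate. By uniqueness \<open>p\<close> is the identity, so this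
  submodule is all of \<open>F\<close>. Uniqueness is tested against the copy of \<open>F\<close> in the right summand of the
  test type.\<close>

lemma free_left_rb_module_generated:
  fixes F :: "('r, 'w, 'f, 'c) left_op_module_scheme" and basis :: "'x set"
  assumes F: "free_left_rb_module TYPE(('r, 'w, 'x, 'f) test_universe) K R Omega lam P basis F j"
  shows "carrier F = generated_submodule R Omega F (j ` basis)"
proof
  have FM: "left_rb_module K R Omega lam P F" and j: "j \<in> basis \<rightarrow> carrier F"
    using F by (simp_all add: free_left_rb_module_def)
  interpret FM: left_rb_module K R Omega lam P F by (rule FM)
  interpret C: rb_submodule K R Omega lam P F "carrier F" by (rule FM.carrier_rb_submodule)
  obtain p where p: "p \<in> left_rb_hom R Omega F F" "\<And>x. x \<in> basis \<Longrightarrow> p (j x) = j x"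
    "p ` carrier F \<subseteq> generated_submodule R Omega F (j ` basis)"
    by (rule free_left_rb_module_extension[OF F FM j]) auto
  let ?e = "Inr :: 'f \<Rightarrow> ('r, 'w, 'x, 'f) test_universe"
  let ?T = "transported_module ?e (carrier F) F"
  have inj: "inj_on ?e (carrier F)" by simp
  have "left_rb_module K R Omega lam P ?T"
    by (rule C.transported_module_is_left_rb_module[OF inj])
  moreover have "?e \<circ> j \<in> basis \<rightarrow> carrier ?T"
    using j by (auto simp: transported_module_def)
  moreover have "?e \<circ> p \<in> left_rb_hom R Omega F ?T"
    by (rule C.transport_hom[OF inj p(1)]) (use left_rb_homD(1)[OF p(1)] in auto)
  moreover have "?e \<circ> id \<in> left_rb_hom R Omega F ?T"
    by (rule C.transport_hom[OF inj]) (auto intro: left_rb_homI)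
  moreover have "\<forall>x\<in>basis. (?e \<circ> p) (j x) = (?e \<circ> j) x" "\<forall>x\<in>basis. (?e \<circ> id) (j x) = (?e \<circ> j) x"
    using p(2) by simp_all
  ultimately have "(?e \<circ> p) y = (?e \<circ> id) y" if "y \<in> carrier F" for y
    using that by (rule free_left_rb_moduleD(2)[OF F])
  then show "carrier F \<subseteq> generated_submodule R Omega F (j ` basis)"
    using p(3) by fastforce
  show "generated_submodule R Omega F (j ` basis) \<subseteq> carrier F"
    using rb_submodule.subset[OF FM.generated_submodule_rb_submodule] j by blast
qed


section \<open>Additive maps out of a right module\<close>

text \<open>For a right module \<open>S\<close> and an abelian group \<open>G\<close> this is \<open>Hom\<^sub>\<int>(S, G)\<close> with
  \<open>(r p)(s) = p (s r)\<close> and with the operators of \<open>S\<close> acting by precomposition. Maps are extensional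
  so that they are determined by their values on \<open>S\<close>.\<close>

definition hom_module ::
    "('r, 'w, 's, 'b) right_op_module_scheme \<Rightarrow> ('g, 'c) ring_scheme \<Rightarrow> ('r, 'w, 's \<Rightarrow> 'g) left_op_module"
  where "hom_module S G =
    \<lparr>carrier = hom (add_monoid S) (add_monoid G) \<inter> extensional (carrier S),
     mult = undefined, one = undefined, ring.zero = (\<lambda>s\<in>carrier S. \<zero>\<^bsub>G\<^esub>),
     ring.add = (\<lambda>p q. \<lambda>s\<in>carrier S. p s \<oplus>\<^bsub>G\<^esub> q s),
     smult = (\<lambda>r p. \<lambda>s\<in>carrier S. p (s \<triangleleft>\<^bsub>S\<^esub> r)),
     lop = (\<lambda>\<omega> p. \<lambda>s\<in>carrier S. p (rop S \<omega> s))\<rparr>"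

lemma hom_module_apply:
  assumes "s \<in> carrier S"
  shows "\<zero>\<^bsub>hom_module S G\<^esub> s = \<zero>\<^bsub>G\<^esub>"
    and "(p \<oplus>\<^bsub>hom_module S G\<^esub> p') s = p s \<oplus>\<^bsub>G\<^esub> p' s"
    and "(r \<odot>\<^bsub>hom_module S G\<^esub> p) s = p (s \<triangleleft>\<^bsub>S\<^esub> r)"
    and "lop (hom_module S G) \<omega> p s = p (rop S \<omega> s)"
    and "lscal R (hom_module S G) c p s = p (rscal R S c s)"
  using assms by (simp_all add: hom_module_def lscal_def rscal_def)

context right_rb_module
begin

text \<open>Precomposition reverses the order of operators and scalars, so applying an additive map to the
  Rota-Baxter identity of \<open>S\<close> gives the one for left modules, term by term. Moving a weight past an
  operator and past an element of \<open>R\<close> uses that the operators are linear and that multiples of the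
  unit are central in \<open>R\<close>.\<close>

lemma hom_module_is_left_rb_module:
  assumes G: "abelian_group G"
  shows "left_rb_module K R Omega lam P (hom_module S G)" (is "left_rb_module K R Omega lam P ?H")
proof -
  interpret G: abelian_group G by (rule G)
  note [simp] = ract_closed lam_closed hom_module_apply
  have rop [simp]: "\<And>\<omega> s. \<lbrakk>\<omega> \<in> Omega; s \<in> carrier S\<rbrakk> \<Longrightarrow> rop S \<omega> s \<in> carrier S"
    using linear_operatorD(1)[OF rop_linear] .
  have P [simp]: "\<And>\<omega> r. \<lbrakk>\<omega> \<in> Omega; r \<in> carrier R\<rbrakk> \<Longrightarrow> P \<omega> r \<in> carrier R"
    using linear_operatorD(1)[OF P_linear] .
  have HD: "p s \<in> carrier G" if "p \<in> carrier ?H" "s \<in> carrier S" for p s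
    using that by (auto simp: hom_module_def hom_def)
  have Hadd: "p (s \<oplus>\<^bsub>S\<^esub> t) = p s \<oplus>\<^bsub>G\<^esub> p t"
    if "p \<in> carrier ?H" "s \<in> carrier S" "t \<in> carrier S" for p s t
    using that by (auto simp: hom_module_def hom_def)
  have HI: "p \<in> carrier ?H" if "p \<in> extensional (carrier S)"
    "\<And>s. s \<in> carrier S \<Longrightarrow> p s \<in> carrier G"
    "\<And>s t. \<lbrakk>s \<in> carrier S; t \<in> carrier S\<rbrakk> \<Longrightarrow> p (s \<oplus>\<^bsub>S\<^esub> t) = p s \<oplus>\<^bsub>G\<^esub> p t" for p
    using that by (auto simp: hom_module_def hom_def)
  have Heq: "p = q" if "p \<in> carrier ?H" "q \<in> carrier ?H" "\<And>s. s \<in> carrier S \<Longrightarrow> p s = q s" for p q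
    using that by (auto simp: hom_module_def intro: extensionalityI)
  \<comment> \<open>With the definition of \<open>hom\<close> unfolded these rules loop, so they are simplification rules from here on only.\<close>
  note [simp] = HD Hadd
  have ext: "\<zero>\<^bsub>?H\<^esub> \<in> extensional (carrier S)"
    "p \<oplus>\<^bsub>?H\<^esub> q \<in> extensional (carrier S)"
    "r \<odot>\<^bsub>?H\<^esub> p \<in> extensional (carrier S)"
    "lop ?H \<omega> p \<in> extensional (carrier S)" for r \<omega> p q
    by (simp_all add: hom_module_def)
  have zero [simp]: "\<zero>\<^bsub>?H\<^esub> \<in> carrier ?H"
    by (rule HI) (simp_all add: ext)
  have add [simp]: "p \<oplus>\<^bsub>?H\<^esub> q \<in> carrier ?H" if "p \<in> carrier ?H" "q \<in> carrier ?H" for p q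
    using that by (intro HI) (simp_all add: ext G.a_ac)
  have act [simp]: "r \<odot>\<^bsub>?H\<^esub> p \<in> carrier ?H" if "r \<in> carrier R" "p \<in> carrier ?H" for r p
    using that by (intro HI) (simp_all add: ext ract_l_distr)
  have op [simp]: "lop ?H \<omega> p \<in> carrier ?H" if "\<omega> \<in> Omega" "p \<in> carrier ?H" for \<omega> p
    using that by (intro HI) (simp_all add: ext linear_operatorD(2)[OF rop_linear])
  have scal [simp]: "lscal R ?H c p \<in> carrier ?H" if "c \<in> carrier K" "p \<in> carrier ?H" for c p
    using that by (simp add: lscal_def)
  have rscal [simp]: "rscal R S c s \<in> carrier S" if "c \<in> carrier K" "s \<in> carrier S" for c s
    using that by (simp add: rscal_def)
  have rscal_ract: "rscal R S c (s \<triangleleft>\<^bsub>S\<^esub> r) = rscal R S c s \<triangleleft>\<^bsub>S\<^esub> r"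
    if "c \<in> carrier K" "s \<in> carrier S" "r \<in> carrier R" for c s r
    using that smult_mult_left[of c "\<one>\<^bsub>R\<^esub>" r] smult_mult_right[of c r "\<one>\<^bsub>R\<^esub>"]
    by (simp add: rscal_def flip: ract_assoc)
  have rscal_rop: "rop S \<omega> (rscal R S c s) = rscal R S c (rop S \<omega> s)"
    if "\<omega> \<in> Omega" "c \<in> carrier K" "s \<in> carrier S" for \<omega> c s
    using linear_operatorD(3)[OF rop_linear] that .
  have "abelian_group ?H"
  proof (rule abelian_groupI)
    fix p assume p: "p \<in> carrier ?H"
    let ?n = "\<lambda>s\<in>carrier S. \<ominus>\<^bsub>G\<^esub> p s"
    have n: "?n \<in> carrier ?H" using p by (intro HI) (simp_all add: G.minus_add)
    have "?n \<oplus>\<^bsub>?H\<^esub> p = \<zero>\<^bsub>?H\<^esub>"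
      using p n by (intro Heq add) (simp_all add: G.l_neg)
    then show "\<exists>q\<in>carrier ?H. q \<oplus>\<^bsub>?H\<^esub> p = \<zero>\<^bsub>?H\<^esub>" using n by blast
  qed (simp, simp, (rule Heq; simp add: G.a_ac)+)
  then interpret H: abelian_group ?H .
  have "left_module R ?H"
    by unfold_locales
      (simp, (rule Heq; simp add: ract_r_distr ract_assoc ract_one)+)
  then interpret HL: left_module R ?H .
  show ?thesis
  proof unfold_locales
    fix w assume w: "w \<in> Omega"
    show "linear_operator K ?H (lscal R ?H) (lop ?H w)"
    proof (rule linear_operatorI)
      show "lop ?H w v \<in> carrier ?H" if "v \<in> carrier ?H" for v
        using w that by simp
      show "lop ?H w (v \<oplus>\<^bsub>?H\<^esub> v') = lop ?H w v \<oplus>\<^bsub>?H\<^esub> lop ?H w v'"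
        if "v \<in> carrier ?H" "v' \<in> carrier ?H" for v v'
        using w that by (intro Heq) simp_all
      show "lop ?H w (lscal R ?H c v) = lscal R ?H c (lop ?H w v)"
        if "c \<in> carrier K" "v \<in> carrier ?H" for c v
        using w that by (intro Heq) (simp_all add: rscal_rop)
    qed
  next
    fix w v r p assume *: "w \<in> Omega" "v \<in> Omega" "r \<in> carrier R" "p \<in> carrier ?H"
    show "P w r \<odot>\<^bsub>?H\<^esub> lop ?H v p =
        lop ?H w (r \<odot>\<^bsub>?H\<^esub> lop ?H v p) \<oplus>\<^bsub>?H\<^esub> lop ?H v (P w r \<odot>\<^bsub>?H\<^esub> p)
        \<oplus>\<^bsub>?H\<^esub> lscal R ?H (lam v) (lop ?H w (r \<odot>\<^bsub>?H\<^esub> p))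
        \<oplus>\<^bsub>?H\<^esub> lscal R ?H (lam w) (lop ?H v (r \<odot>\<^bsub>?H\<^esub> p))"
      using * by (intro Heq) (simp_all add: right_rota_baxter rscal_ract rscal_rop)
  qed
qed

end


section \<open>Formal sums modulo the tensor relations\<close>

lemma right_rb_homD:
  assumes "h \<in> right_rb_hom R Omega S T"
  shows "s \<in> carrier S \<Longrightarrow> h s \<in> carrier T"
    and "\<lbrakk>s \<in> carrier S; s' \<in> carrier S\<rbrakk> \<Longrightarrow> h (s \<oplus>\<^bsub>S\<^esub> s') = h s \<oplus>\<^bsub>T\<^esub> h s'"
    and "\<lbrakk>r \<in> carrier R; s \<in> carrier S\<rbrakk> \<Longrightarrow> h (s \<triangleleft>\<^bsub>S\<^esub> r) = h s \<triangleleft>\<^bsub>T\<^esub> r"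
    and "\<lbrakk>\<omega> \<in> Omega; s \<in> carrier S\<rbrakk> \<Longrightarrow> h (rop S \<omega> s) = rop T \<omega> (h s)"
  using assms by (auto simp: right_rb_hom_def hom_def)

lemma tensor_relationsE:
  assumes "z \<in> tensor_relations R Omega S M"
  obtains
    (add_left) s s' m where "z = frag_of (s \<oplus>\<^bsub>S\<^esub> s', m) - frag_of (s, m) - frag_of (s', m)"
      "s \<in> carrier S" "s' \<in> carrier S" "m \<in> carrier M"
  | (add_right) s m m' where "z = frag_of (s, m \<oplus>\<^bsub>M\<^esub> m') - frag_of (s, m) - frag_of (s, m')"
      "s \<in> carrier S" "m \<in> carrier M" "m' \<in> carrier M"
  | (act) s r m where "z = frag_of (s \<triangleleft>\<^bsub>S\<^esub> r, m) - frag_of (s, r \<odot>\<^bsub>M\<^esub> m)"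
      "s \<in> carrier S" "r \<in> carrier R" "m \<in> carrier M"
  | (oper) s \<omega> m where "z = frag_of (rop S \<omega> s, m) - frag_of (s, lop M \<omega> m)"
      "s \<in> carrier S" "\<omega> \<in> Omega" "m \<in> carrier M"
  using assms unfolding tensor_relations_def
  by (elim UnE CollectE exE conjE)
    (erule (3) that(1), erule (3) that(2), erule (3) that(3), erule (3) that(4))

locale tensor_pair =
  S: right_rb_module K R Omega lam P S + M: left_rb_module K R Omega lam P M
  for K :: "('k, 'a) ring_scheme" and R :: "('k, 'r, 'b) module_scheme"
    and Omega :: "'w set" and lam and P
    and S :: "('r, 'w, 's, 'c) right_op_module_scheme"
    and M :: "('r, 'w, 'm, 'd) left_op_module_scheme"
begin

abbreviation formal_sums :: "('s \<times> 'm \<Rightarrow>\<^sub>0 int) monoid"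
  where "formal_sums \<equiv> free_Abelian_group (carrier S \<times> carrier M)"

abbreviation relators :: "('s \<times> 'm \<Rightarrow>\<^sub>0 int) set"
  where "relators \<equiv> tensor_kernel R Omega S M"

lemma rop_closed: "\<lbrakk>\<omega> \<in> Omega; s \<in> carrier S\<rbrakk> \<Longrightarrow> rop S \<omega> s \<in> carrier S"
  using linear_operatorD(1)[OF S.rop_linear] .

lemma lop_closed: "\<lbrakk>\<omega> \<in> Omega; m \<in> carrier M\<rbrakk> \<Longrightarrow> lop M \<omega> m \<in> carrier M"
  using linear_operatorD(1)[OF M.lop_linear] .

lemma tensor_relations_subset: "tensor_relations R Omega S M \<subseteq> carrier formal_sums"
proof -
  have diff: "a - b \<in> carrier formal_sums" if "a \<in> carrier formal_sums" "b \<in> carrier formal_sums" for a b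
    using that keys_diff[of a b] by auto
  show ?thesis
    unfolding tensor_relations_def
    by (auto simp del: carrier_free_Abelian_group_iff intro!: diff
        simp: S.ract_closed M.lact_closed rop_closed lop_closed)
qed

lemma relators_subgroup: "subgroup relators formal_sums"
  unfolding tensor_kernel_def
  by (rule group.generate_is_subgroup[OF group_free_Abelian_group tensor_relations_subset])

lemma relators_normal: "relators \<lhd> formal_sums"
  by (rule comm_group.normal_iff_subgroup[THEN iffD2, OF abelian_free_Abelian_group relators_subgroup])

lemma relators_zero: "0 \<in> relators"
  using subgroup.one_closed[OF relators_subgroup] by simp

lemma relators_add: "\<lbrakk>z \<in> relators; z' \<in> relators\<rbrakk> \<Longrightarrow> z + z' \<in> relators"
  using subgroup.m_closed[OF relators_subgroup] by simp

lemma relators_uminus: "z \<in> relators \<Longrightarrow> - z \<in> relators"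
  using subgroup.m_inv_closed[OF relators_subgroup] subgroup.mem_carrier[OF relators_subgroup]
  by (metis carrier_free_Abelian_group_iff inv_free_Abelian_group)

lemma relators_diff: "\<lbrakk>z \<in> relators; z' \<in> relators\<rbrakk> \<Longrightarrow> z - z' \<in> relators"
  using relators_add relators_uminus by fastforce

lemma relators_sum: "(\<And>x. x \<in> I \<Longrightarrow> z x \<in> relators) \<Longrightarrow> (\<Sum>x\<in>I. z x) \<in> relators"
  by (induction I rule: infinite_finite_induct) (auto intro: relators_zero relators_add)

lemma tensor_add_left: "\<lbrakk>s \<in> carrier S; s' \<in> carrier S; m \<in> carrier M\<rbrakk>
    \<Longrightarrow> frag_of (s \<oplus>\<^bsub>S\<^esub> s', m) - frag_of (s, m) - frag_of (s', m) \<in> relators"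
  and tensor_add_right: "\<lbrakk>s \<in> carrier S; m \<in> carrier M; m' \<in> carrier M\<rbrakk>
    \<Longrightarrow> frag_of (s, m \<oplus>\<^bsub>M\<^esub> m') - frag_of (s, m) - frag_of (s, m') \<in> relators"
  and tensor_act: "\<lbrakk>s \<in> carrier S; r \<in> carrier R; m \<in> carrier M\<rbrakk>
    \<Longrightarrow> frag_of (s \<triangleleft>\<^bsub>S\<^esub> r, m) - frag_of (s, r \<odot>\<^bsub>M\<^esub> m) \<in> relators"
  and tensor_oper: "\<lbrakk>s \<in> carrier S; \<omega> \<in> Omega; m \<in> carrier M\<rbrakk>
    \<Longrightarrow> frag_of (rop S \<omega> s, m) - frag_of (s, lop M \<omega> m) \<in> relators"
  unfolding tensor_kernel_def tensor_relations_def
  by (rule generate.incl; blast)+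

lemma tensor_zero_left: "m \<in> carrier M \<Longrightarrow> frag_of (\<zero>\<^bsub>S\<^esub>, m) \<in> relators"
  using relators_uminus[OF tensor_add_left[of "\<zero>\<^bsub>S\<^esub>" "\<zero>\<^bsub>S\<^esub>" m]] by simp

lemma tensor_zero_right: "s \<in> carrier S \<Longrightarrow> frag_of (s, \<zero>\<^bsub>M\<^esub>) \<in> relators"
  using relators_uminus[OF tensor_add_right[of s "\<zero>\<^bsub>M\<^esub>" "\<zero>\<^bsub>M\<^esub>"]] by simp

lemma tensor_minus_left:
  assumes "s \<in> carrier S" "s' \<in> carrier S" "m \<in> carrier M"
  shows "frag_of (s, m) - frag_of (s', m) - frag_of (s \<ominus>\<^bsub>S\<^esub> s', m) \<in> relators"
proof -
  have "(s \<ominus>\<^bsub>S\<^esub> s') \<oplus>\<^bsub>S\<^esub> s' = s"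
    using assms by (simp add: a_minus_def S.a_assoc S.N.S.l_neg)
  then show ?thesis
    using tensor_add_left[of "s \<ominus>\<^bsub>S\<^esub> s'" s' m] assms by (simp add: algebra_simps)
qed

lemma tensor_uminus_right:
  assumes "s \<in> carrier S" "m \<in> carrier M"
  shows "frag_of (s, \<ominus>\<^bsub>M\<^esub> m) + frag_of (s, m) \<in> relators"
proof -
  have "frag_of (s, \<zero>\<^bsub>M\<^esub>) - (frag_of (s, \<ominus>\<^bsub>M\<^esub> m \<oplus>\<^bsub>M\<^esub> m) - frag_of (s, \<ominus>\<^bsub>M\<^esub> m) - frag_of (s, m)) \<in> relators"
    using assms by (intro relators_diff tensor_zero_right tensor_add_right) auto
  then show ?thesis using assms by (simp add: M.L.M.l_neg add.commute)
qed

lemma hom_vanishing_on_relators: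
  assumes H: "group H" and h: "h \<in> hom formal_sums H"
    and rel: "\<And>z. z \<in> tensor_relations R Omega S M \<Longrightarrow> h z = \<one>\<^bsub>H\<^esub>" and z: "z \<in> relators"
  shows "h z = \<one>\<^bsub>H\<^esub>"
proof -
  interpret h: group_hom formal_sums H h
    using H h by (simp add: group_hom_def group_hom_axioms_def)
  have "relators \<subseteq> kernel formal_sums H h"
    unfolding tensor_kernel_def
    by (rule h.G.generate_subgroup_incl[OF _ h.subgroup_kernel])
      (use tensor_relations_subset rel in \<open>auto simp: kernel_def simp del: carrier_free_Abelian_group_iff\<close>)
  then show ?thesis using z by (auto simp: kernel_def)
qed

lemma coset_eq_iff:
  assumes "z \<in> carrier formal_sums" "z' \<in> carrier formal_sums"
  shows "relators #>\<^bsub>formal_sums\<^esub> z = relators #>\<^bsub>formal_sums\<^esub> z' \<longleftrightarrow> z - z' \<in> relators"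
proof -
  interpret N: normal relators formal_sums by (rule relators_normal)
  have "z \<in> relators #>\<^bsub>formal_sums\<^esub> z' \<longleftrightarrow> z - z' \<in> relators"
    using N.rcos_module[OF N.is_group assms(2,1)] assms by simp
  then show ?thesis
    using N.rcos_self[OF assms(1) N.subgroup_axioms] N.repr_independence[OF _ assms(2) N.subgroup_axioms] by auto
qed

end

text \<open>An additive map from \<open>S \<otimes> M\<close> to \<open>G\<close> is the same as a homomorphism of left modules from \<open>M\<close> to
  \<open>Hom\<^sub>\<int>(S, G)\<close>. When \<open>M\<close> is free, such a homomorphism can be prescribed on the generators, which
  gives a map on the tensor product with prescribed values on the elements \<open>s \<otimes> j x\<close>.\<close>

lemma (in tensor_pair) tensor_free_universal:
  fixes G :: "('g, 'e) ring_scheme" and basis :: "'x set"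
  assumes F: "free_left_rb_module TYPE(('r, 'w, 'x, 'm) test_universe) K R Omega lam P basis M j"
    and G: "abelian_group G"
    and p: "\<And>x. x \<in> basis \<Longrightarrow> p x \<in> hom (add_monoid S) (add_monoid G)"
  obtains h where "h \<in> hom formal_sums (add_monoid G)"
    "\<And>z. z \<in> relators \<Longrightarrow> h z = \<zero>\<^bsub>G\<^esub>"
    "\<And>s x. \<lbrakk>s \<in> carrier S; x \<in> basis\<rbrakk> \<Longrightarrow> h (frag_of (s, j x)) = p x s"
proof -
  interpret G: abelian_group G by (rule G)
  let ?H = "hom_module S G"
  have j: "j x \<in> carrier M" if "x \<in> basis" for x
    using F that by (auto simp: free_left_rb_module_def)
  have "(\<lambda>x. restrict (p x) (carrier S)) \<in> basis \<rightarrow> carrier ?H"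
    using p S.N.S.add.m_closed by (auto simp: hom_module_def hom_def)
  then obtain q where q: "q \<in> left_rb_hom R Omega M ?H"
    and qj: "\<And>x. x \<in> basis \<Longrightarrow> q (j x) = restrict (p x) (carrier S)"
    by (rule free_left_rb_module_extension[OF F S.hom_module_is_left_rb_module[OF G]]) auto
  have qH: "q m \<in> hom (add_monoid S) (add_monoid G)" if "m \<in> carrier M" for m
    using left_rb_homD(1)[OF q that] by (simp add: hom_module_def)
  have "(\<lambda>(s, m). q m s) ` (carrier S \<times> carrier M) \<subseteq> carrier (add_monoid G)"
    using add_monoid_homD(1)[OF qH] by auto
  then obtain h where h: "h \<in> hom formal_sums (add_monoid G)"
    and hf: "\<And>s m. \<lbrakk>s \<in> carrier S; m \<in> carrier M\<rbrakk> \<Longrightarrow> h (frag_of (s, m)) = q m s"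
    by (rule comm_group.free_Abelian_group_universal[OF G.a_comm_group]) auto
  interpret h: group_hom formal_sums "add_monoid G" h
    using h G.a_group by (simp add: group_hom_def group_hom_axioms_def)
  have hdiff: "h (a - b) = h a \<ominus>\<^bsub>G\<^esub> h b" if "a \<in> carrier formal_sums" "b \<in> carrier formal_sums" for a b
    using h.hom_mult[of a "- b"] h.hom_inv[of b] that by (simp add: a_minus_def a_inv_def)
  have cdiff: "a - b \<in> carrier formal_sums" if "a \<in> carrier formal_sums" "b \<in> carrier formal_sums" for a b
    using that keys_diff[of a b] by auto
  have qc: "q m s \<in> carrier G" if "m \<in> carrier M" "s \<in> carrier S" for m s
    using add_monoid_homD(1)[OF qH] that .
  have h2: "h (frag_of (s, m) - frag_of (s', m')) = q m s \<ominus>\<^bsub>G\<^esub> q m' s'"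
    if "s \<in> carrier S" "m \<in> carrier M" "s' \<in> carrier S" "m' \<in> carrier M" for s m s' m'
    using that by (subst hdiff) (simp_all add: hf)
  have h3: "h (frag_of (s, m) - frag_of (s', m') - frag_of (s'', m'')) = q m s \<ominus>\<^bsub>G\<^esub> q m' s' \<ominus>\<^bsub>G\<^esub> q m'' s''"
    if "s \<in> carrier S" "m \<in> carrier M" "s' \<in> carrier S" "m' \<in> carrier M" "s'' \<in> carrier S" "m'' \<in> carrier M"
    for s m s' m' s'' m''
    using that by (subst hdiff) (simp_all add: h2 hf cdiff del: carrier_free_Abelian_group_iff)
  have one: "\<one>\<^bsub>add_monoid G\<^esub> = \<zero>\<^bsub>G\<^esub>" by simp
  note cl = S.ract_closed M.lact_closed rop_closed lop_closed
  have cancel: "(a \<oplus>\<^bsub>G\<^esub> b) \<ominus>\<^bsub>G\<^esub> a \<ominus>\<^bsub>G\<^esub> b = \<zero>\<^bsub>G\<^esub>" if "a \<in> carrier G" "b \<in> carrier G" for a b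
  proof -
    have "(a \<oplus>\<^bsub>G\<^esub> b) \<ominus>\<^bsub>G\<^esub> a \<ominus>\<^bsub>G\<^esub> b = (a \<oplus>\<^bsub>G\<^esub> b) \<oplus>\<^bsub>G\<^esub> \<ominus>\<^bsub>G\<^esub> (a \<oplus>\<^bsub>G\<^esub> b)"
      using that by (simp add: a_minus_def G.minus_add G.a_assoc)
    then show ?thesis using that by (simp add: G.r_neg)
  qed
  have minus_self: "a \<ominus>\<^bsub>G\<^esub> a = \<zero>\<^bsub>G\<^esub>" if "a \<in> carrier G" for a
    using that by (simp add: a_minus_def G.r_neg)
  show thesis
  proof
    show "h z = \<zero>\<^bsub>G\<^esub>" if "z \<in> relators" for z
    proof -
      have "h z = \<one>\<^bsub>add_monoid G\<^esub>"
      proof (rule hom_vanishing_on_relators[OF G.a_group h _ that])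
        fix z assume "z \<in> tensor_relations R Omega S M"
        then show "h z = \<one>\<^bsub>add_monoid G\<^esub>"
        proof (cases rule: tensor_relationsE)
          case (add_left s s' m)
          have "q m (s \<oplus>\<^bsub>S\<^esub> s') = q m s \<oplus>\<^bsub>G\<^esub> q m s'"
            by (rule add_monoid_homD(2)[OF qH]) fact+
          moreover have "s \<oplus>\<^bsub>S\<^esub> s' \<in> carrier S" using add_left by simp
          ultimately show ?thesis
            unfolding add_left(1) using add_left(2-4) by (simp only: h3 cancel qc one)
        next
          case (add_right s m m')
          have "q (m \<oplus>\<^bsub>M\<^esub> m') s = q m s \<oplus>\<^bsub>G\<^esub> q m' s"
            using add_right by (simp only: left_rb_homD(2)[OF q] hom_module_apply)
          moreover have "m \<oplus>\<^bsub>M\<^esub> m' \<in> carrier M" using add_right by simp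
          ultimately show ?thesis
            unfolding add_right(1) using add_right(2-4) by (simp only: h3 cancel qc one)
        next
          case (act s r m)
          have "q (r \<odot>\<^bsub>M\<^esub> m) s = q m (s \<triangleleft>\<^bsub>S\<^esub> r)"
            using act by (simp only: left_rb_homD(3)[OF q] hom_module_apply)
          then show ?thesis
            unfolding act(1) using act(2-4) by (simp only: h2 cl qc minus_self one)
        next
          case (oper s \<omega> m)
          have "q (lop M \<omega> m) s = q m (rop S \<omega> s)"
            using oper by (simp only: left_rb_homD(4)[OF q] hom_module_apply)
          then show ?thesis
            unfolding oper(1) using oper(2-4) by (simp only: h2 cl qc minus_self one)
        qed
      qed
      then show ?thesis by simp
    qed
    show "h (frag_of (s, j x)) = p x s" if "s \<in> carrier S" "x \<in> basis" for s x
      using that j by (simp add: hf qj)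
  qed (rule h)
qed


section \<open>Normal forms in the tensor product with a free module\<close>

definition basis_sum :: "('x \<Rightarrow> 'm) \<Rightarrow> ('x \<Rightarrow> 's) \<Rightarrow> 'x set \<Rightarrow> 's \<times> 'm \<Rightarrow>\<^sub>0 int"
  where "basis_sum j u I = (\<Sum>x\<in>I. frag_of (u x, j x))"

definition formal_map :: "('s \<Rightarrow> 't) \<Rightarrow> ('s \<times> 'm \<Rightarrow>\<^sub>0 int) \<Rightarrow> 't \<times> 'm \<Rightarrow>\<^sub>0 int"
  where "formal_map f = frag_extend (\<lambda>(s, m). frag_of (f s, m))"

lemma formal_map_diff: "formal_map f (a - b) = formal_map f a - formal_map f b"
  and formal_map_add: "formal_map f (a + b) = formal_map f a + formal_map f b"
  and formal_map_of [simp]: "formal_map f (frag_of (s, m)) = frag_of (f s, m)"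
  by (simp_all add: formal_map_def frag_extend_diff frag_extend_add)

lemma formal_map_basis_sum: "finite I \<Longrightarrow> formal_map f (basis_sum j u I) = basis_sum j (f \<circ> u) I"
  by (simp add: basis_sum_def formal_map_def frag_extend_sum o_def)

lemma basis_sum_cong: "(\<And>x. x \<in> I \<Longrightarrow> u x = v x) \<Longrightarrow> basis_sum j u I = basis_sum j v I"
  by (simp add: basis_sum_def)

lemma formal_map_hom:
  assumes "f ` A \<subseteq> B"
  shows "formal_map f \<in> hom (free_Abelian_group (A \<times> M)) (free_Abelian_group (B \<times> M))"
proof (rule homI)
  fix z assume "z \<in> carrier (free_Abelian_group (A \<times> M))"
  then have "Poly_Mapping.keys z \<subseteq> A \<times> M" by simp
  then show "formal_map f z \<in> carrier (free_Abelian_group (B \<times> M))"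
    unfolding formal_map_def carrier_free_Abelian_group_iff
    by (intro order_trans[OF keys_frag_extend]) (use \<open>Poly_Mapping.keys z \<subseteq> A \<times> M\<close> assms in fastforce)
qed (simp add: formal_map_add)

text \<open>The next locale establishes \<open>S \<otimes> M \<cong> \<Oplus>\<^sub>x S\<close> for a free module \<open>M\<close>, in the form of existence and
  uniqueness of a normal form \<open>\<Sum>\<^sub>x u x \<otimes> j x\<close>.\<close>

locale free_tensor_pair = tensor_pair K R Omega lam P S M
  for K :: "('k, 'a) ring_scheme" and R :: "('k, 'r, 'b) module_scheme"
    and Omega :: "'w set" and lam and P
    and S :: "('r, 'w, 's, 'c) right_op_module_scheme"
    and M :: "('r, 'w, 'm, 'd) left_op_module_scheme" +
  fixes basis :: "'x set" and j :: "'x \<Rightarrow> 'm"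
  assumes free: "free_left_rb_module TYPE(('r, 'w, 'x, 'm) test_universe) K R Omega lam P basis M j"
begin

lemma j_closed: "x \<in> basis \<Longrightarrow> j x \<in> carrier M"
  using free by (auto simp: free_left_rb_module_def)

definition has_normal_form :: "('s \<times> 'm \<Rightarrow>\<^sub>0 int) \<Rightarrow> bool"
  where "has_normal_form z \<longleftrightarrow>
    (\<exists>I u. finite I \<and> I \<subseteq> basis \<and> u \<in> I \<rightarrow> carrier S \<and> z - basis_sum j u I \<in> relators)"

text \<open>Padding with zeros brings two normal forms to a common index set.\<close>

lemma basis_sum_extend:
  assumes "finite J" "I \<subseteq> J" "J \<subseteq> basis"
  shows "basis_sum j u I - basis_sum j (\<lambda>x. if x \<in> I then u x else \<zero>\<^bsub>S\<^esub>) J \<in> relators"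
proof -
  let ?u = "\<lambda>x. if x \<in> I then u x else \<zero>\<^bsub>S\<^esub>"
  have "basis_sum j ?u J = basis_sum j ?u I + basis_sum j ?u (J - I)"
    unfolding basis_sum_def by (subst add.commute) (rule sum.subset_diff[OF assms(2,1)])
  also have "basis_sum j ?u I = basis_sum j u I"
    by (rule basis_sum_cong) simp
  finally have "basis_sum j u I - basis_sum j ?u J = - basis_sum j ?u (J - I)"
    by simp
  moreover have "basis_sum j ?u (J - I) \<in> relators"
    unfolding basis_sum_def using assms(3)
    by (intro relators_sum) (auto intro: tensor_zero_left j_closed)
  ultimately show ?thesis using relators_uminus by simp
qed

lemma has_normal_form_cong:
  assumes "has_normal_form z'" "z - z' \<in> relators"
  shows "has_normal_form z"
proof -
  obtain I u where I: "finite I" "I \<subseteq> basis" "u \<in> I \<rightarrow> carrier S" "z' - basis_sum j u I \<in> relators"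
    using assms(1) by (auto simp: has_normal_form_def)
  have "z - basis_sum j u I \<in> relators"
    using relators_add[OF assms(2) I(4)] by simp
  then show ?thesis using I by (auto simp: has_normal_form_def)
qed

lemma has_normal_form_zero: "has_normal_form 0"
  unfolding has_normal_form_def
  by (rule exI[of _ "{}"]) (simp add: basis_sum_def relators_zero)

lemma has_normal_form_diff:
  assumes "has_normal_form z" "has_normal_form z'"
  shows "has_normal_form (z - z')"
proof -
  obtain I u where I: "finite I" "I \<subseteq> basis" "u \<in> I \<rightarrow> carrier S" "z - basis_sum j u I \<in> relators"
    using assms(1) by (auto simp: has_normal_form_def)
  obtain J v where J: "finite J" "J \<subseteq> basis" "v \<in> J \<rightarrow> carrier S" "z' - basis_sum j v J \<in> relators"
    using assms(2) by (auto simp: has_normal_form_def)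
  let ?u = "\<lambda>x. if x \<in> I then u x else \<zero>\<^bsub>S\<^esub>" and ?v = "\<lambda>x. if x \<in> J then v x else \<zero>\<^bsub>S\<^esub>"
  let ?w = "\<lambda>x. ?u x \<ominus>\<^bsub>S\<^esub> ?v x" and ?L = "I \<union> J"
  have uv: "?u x \<in> carrier S" "?v x \<in> carrier S" for x
    using I(3) J(3) by auto
  have "basis_sum j ?u ?L - basis_sum j ?v ?L - basis_sum j ?w ?L =
      (\<Sum>x\<in>?L. frag_of (?u x, j x) - frag_of (?v x, j x) - frag_of (?w x, j x))"
    by (simp add: basis_sum_def sum_subtractf)
  moreover have "\<dots> \<in> relators"
    by (rule relators_sum, rule tensor_minus_left) (use uv j_closed I(2) J(2) in auto)
  ultimately have 1: "basis_sum j ?u ?L - basis_sum j ?v ?L - basis_sum j ?w ?L \<in> relators" by simp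
  have 2: "basis_sum j u I - basis_sum j ?u ?L \<in> relators"
    by (rule basis_sum_extend) (use I J in auto)
  have 3: "basis_sum j v J - basis_sum j ?v ?L \<in> relators"
    by (rule basis_sum_extend) (use I J in auto)
  have "((z - basis_sum j u I) + (basis_sum j u I - basis_sum j ?u ?L))
      - ((z' - basis_sum j v J) + (basis_sum j v J - basis_sum j ?v ?L))
      + (basis_sum j ?u ?L - basis_sum j ?v ?L - basis_sum j ?w ?L) \<in> relators"
    by (intro relators_add relators_diff I(4) J(4) 1 2 3)
  then have "z - z' - basis_sum j ?w ?L \<in> relators" by (simp add: algebra_simps)
  moreover have "?w \<in> ?L \<rightarrow> carrier S" using uv by (auto simp: a_minus_def)
  ultimately show ?thesis
    unfolding has_normal_form_def using I(1,2) J(1,2)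
    by (intro exI[of _ ?L] exI[of _ ?w]) auto
qed

text \<open>Since \<open>M\<close> is generated by the elements \<open>j x\<close>, induction on the way in which \<open>m\<close> is built from them
  applies; scalars and operators on the right factor are moved over to the left factor, whence the
  generalisation over \<open>s\<close>.\<close>

lemma has_normal_form_generator:
  assumes "m \<in> carrier M" "s \<in> carrier S"
  shows "has_normal_form (frag_of (s, m))"
proof -
  have gen: "carrier M = generated_submodule R Omega M (j ` basis)"
    by (rule free_left_rb_module_generated[OF free])
  from assms(1) have "m \<in> generated_submodule R Omega M (j ` basis)" by (simp add: gen)
  then show ?thesis using assms(2)
  proof (induction arbitrary: s)
    case (gen y)
    then obtain x where "x \<in> basis" "y = j x" by blast
    then show ?case
      unfolding has_normal_form_def using gen(2)
      by (intro exI[of _ "{x}"] exI[of _ "\<lambda>_. s"]) (simp add: basis_sum_def relators_zero)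
  next
    case zero
    then show ?case
      by (intro has_normal_form_cong[OF has_normal_form_zero]) (simp add: tensor_zero_right)
  next
    case (neg m)
    have "frag_of (s, \<ominus>\<^bsub>M\<^esub> m) - (0 - frag_of (s, m)) \<in> relators"
      using tensor_uminus_right[of s m] neg(1,3) by (simp add: gen)
    then show ?case
      by (rule has_normal_form_cong[rotated])
        (intro has_normal_form_diff has_normal_form_zero neg)
  next
    case (add m n)
    have "frag_of (s, m \<oplus>\<^bsub>M\<^esub> n) - (frag_of (s, m) - (0 - frag_of (s, n))) \<in> relators"
      using tensor_add_right[of s m n] add(1,2,5) by (simp add: gen algebra_simps)
    then show ?case
      by (rule has_normal_form_cong[rotated])
        (intro has_normal_form_diff has_normal_form_zero add)
  next
    case (act r m)
    have "frag_of (s, r \<odot>\<^bsub>M\<^esub> m) - frag_of (s \<triangleleft>\<^bsub>S\<^esub> r, m) \<in> relators"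
      using relators_uminus[OF tensor_act[of s r m]] act(1,2,4) by (simp add: gen)
    then show ?case
      by (rule has_normal_form_cong[rotated]) (intro act S.ract_closed)
  next
    case (oper \<omega> m)
    have "frag_of (s, lop M \<omega> m) - frag_of (rop S \<omega> s, m) \<in> relators"
      using relators_uminus[OF tensor_oper[of s \<omega> m]] oper(1,2,4) by (simp add: gen)
    then show ?case
      by (rule has_normal_form_cong[rotated]) (intro oper rop_closed)
  qed
qed

lemma normal_form:
  assumes "z \<in> carrier formal_sums"
  obtains I u where "finite I" "I \<subseteq> basis" "u \<in> I \<rightarrow> carrier S" "z - basis_sum j u I \<in> relators"
proof -
  have "Poly_Mapping.keys z \<subseteq> carrier S \<times> carrier M" using assms by simp
  then have "has_normal_form z"
    by (induction rule: frag_induction)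
      (auto intro: has_normal_form_zero has_normal_form_generator has_normal_form_diff)
  then show thesis using that by (auto simp: has_normal_form_def)
qed

lemma basis_sum_in_formal_sums:
  assumes "finite I" "I \<subseteq> basis" "u \<in> I \<rightarrow> carrier S"
  shows "basis_sum j u I \<in> carrier formal_sums"
  using assms j_closed keys_sum[of "\<lambda>x. frag_of (u x, j x)" I]
  by (fastforce simp: basis_sum_def)

text \<open>Coefficients of a normal form are unique: for each \<open>x\<close> the universal property provides a
  coordinate map \<open>S \<otimes> M \<rightarrow> S\<close> that sends \<open>s \<otimes> j x\<close> to \<open>s\<close> and kills \<open>s \<otimes> j y\<close> for \<open>y \<noteq> x\<close>.\<close>

lemma basis_sum_in_relators_iff:
  assumes "finite I" "I \<subseteq> basis" "u \<in> I \<rightarrow> carrier S"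
  shows "basis_sum j u I \<in> relators \<longleftrightarrow> (\<forall>x\<in>I. u x = \<zero>\<^bsub>S\<^esub>)"
proof
  assume "\<forall>x\<in>I. u x = \<zero>\<^bsub>S\<^esub>"
  then show "basis_sum j u I \<in> relators"
    unfolding basis_sum_def using assms(2)
    by (intro relators_sum) (auto intro: tensor_zero_left j_closed)
next
  assume rel: "basis_sum j u I \<in> relators"
  show "\<forall>x\<in>I. u x = \<zero>\<^bsub>S\<^esub>"
  proof
    fix x assume x: "x \<in> I"
    \<comment> \<open>The case distinction is on indices, so \<open>j\<close> may identify generators (as when \<open>R\<close> is zero).\<close>
    let ?p = "\<lambda>y s. if y = x then s else \<zero>\<^bsub>S\<^esub>"
    have S: "abelian_group S" by (rule S.N.S.abelian_group_axioms)
    obtain h where h: "h \<in> hom formal_sums (add_monoid S)"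
      and h0: "\<And>z. z \<in> relators \<Longrightarrow> h z = \<zero>\<^bsub>S\<^esub>"
      and hj: "\<And>s y. \<lbrakk>s \<in> carrier S; y \<in> basis\<rbrakk> \<Longrightarrow> h (frag_of (s, j y)) = ?p y s"
      by (rule tensor_free_universal[OF free S, of ?p]) (auto simp: hom_def)
    interpret h: group_hom formal_sums "add_monoid S" h
      using h S by (simp add: group_hom_def group_hom_axioms_def abelian_group.a_group)
    have "h (basis_sum j u J) = (if x \<in> J then u x else \<zero>\<^bsub>S\<^esub>)" if "J \<subseteq> I" for J
      using finite_subset[OF that assms(1)] that
    proof (induction J rule: finite_induct)
      case empty
      then show ?case using h.hom_one by (simp add: basis_sum_def)
    next
      case (insert y J)
      have uy: "u y \<in> carrier S" "y \<in> basis" using insert(4) assms by auto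
      have J: "basis_sum j u J \<in> carrier formal_sums"
        by (rule basis_sum_in_formal_sums) (use insert assms in auto)
      have "basis_sum j u (insert y J) = frag_of (u y, j y) + basis_sum j u J"
        using insert by (simp add: basis_sum_def)
      then have "h (basis_sum j u (insert y J)) = ?p y (u y) \<oplus>\<^bsub>S\<^esub> h (basis_sum j u J)"
        using h.hom_mult[of "frag_of (u y, j y)" "basis_sum j u J"] J uy j_closed
        by (simp add: hj)
      moreover have "u x \<in> carrier S" using x assms(3) by auto
      ultimately show ?case using insert uy by auto
    qed
    then show "u x = \<zero>\<^bsub>S\<^esub>" using h0[OF rel] x by auto
  qed
qed

lemma in_relators_iff:
  assumes "z - z' \<in> relators"
  shows "z \<in> relators \<longleftrightarrow> z' \<in> relators"
  using relators_diff[OF _ assms, of z] relators_add[OF assms, of z'] by auto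

end


section \<open>Induced maps and exactness\<close>

lemma formal_map_relators:
  assumes "right_rb_module K R Omega lam P S" "right_rb_module K R Omega lam P T"
    and "left_rb_module K R Omega lam P M" and f: "f \<in> right_rb_hom R Omega S T"
    and z: "z \<in> tensor_kernel R Omega S M"
  shows "formal_map f z \<in> tensor_kernel R Omega T M"
proof -
  interpret S: tensor_pair K R Omega lam P S M using assms by (simp add: tensor_pair_def)
  interpret T: tensor_pair K R Omega lam P T M using assms by (simp add: tensor_pair_def)
  have "formal_map f \<in> hom S.formal_sums T.formal_sums"
    by (rule formal_map_hom) (use right_rb_homD(1)[OF f] in auto)
  then interpret h: group_hom S.formal_sums T.formal_sums "formal_map f"
    by (simp add: group_hom_def group_hom_axioms_def)
  have rel: "formal_map f ` tensor_relations R Omega S M \<subseteq> tensor_relations R Omega T M"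
  proof (rule image_subsetI)
    fix z assume "z \<in> tensor_relations R Omega S M"
    then show "formal_map f z \<in> tensor_relations R Omega T M"
    proof (cases rule: tensor_relationsE)
      case (add_left s s' m)
      then have "formal_map f z = frag_of (f s \<oplus>\<^bsub>T\<^esub> f s', m) - frag_of (f s, m) - frag_of (f s', m)"
        by (simp add: formal_map_diff right_rb_homD[OF f])
      then show ?thesis using add_left right_rb_homD(1)[OF f]
        unfolding tensor_relations_def by blast
    next
      case (add_right s m m')
      then have "formal_map f z = frag_of (f s, m \<oplus>\<^bsub>M\<^esub> m') - frag_of (f s, m) - frag_of (f s, m')"
        by (simp add: formal_map_diff)
      then show ?thesis using add_right right_rb_homD(1)[OF f]
        unfolding tensor_relations_def by blast
    next
      case (act s r m)
      then have "formal_map f z = frag_of (f s \<triangleleft>\<^bsub>T\<^esub> r, m) - frag_of (f s, r \<odot>\<^bsub>M\<^esub> m)"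
        by (simp add: formal_map_diff right_rb_homD[OF f])
      then show ?thesis using act right_rb_homD(1)[OF f]
        unfolding tensor_relations_def by blast
    next
      case (oper s \<omega> m)
      then have "formal_map f z = frag_of (rop T \<omega> (f s), m) - frag_of (f s, lop M \<omega> m)"
        by (simp add: formal_map_diff right_rb_homD[OF f])
      then show ?thesis using oper right_rb_homD(1)[OF f]
        unfolding tensor_relations_def by blast
    qed
  qed
  have "formal_map f ` tensor_kernel R Omega S M
      = generate T.formal_sums (formal_map f ` tensor_relations R Omega S M)"
    unfolding tensor_kernel_def by (rule h.generate_img[OF S.tensor_relations_subset, symmetric])
  also have "\<dots> \<subseteq> tensor_kernel R Omega T M"
    unfolding tensor_kernel_def by (rule h.H.mono_generate[OF rel])
  finally show ?thesis using z by blast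
qed

text \<open>The induced map was defined as the only element of the image of a coset; the image is a
  singleton because relators go to relators.\<close>

lemma tensor_map_coset:
  assumes "right_rb_module K R Omega lam P S" "right_rb_module K R Omega lam P T"
    and "left_rb_module K R Omega lam P M" and f: "f \<in> right_rb_hom R Omega S T"
    and z: "z \<in> carrier (free_Abelian_group (carrier S \<times> carrier M))"
  shows "tensor_map R Omega T M f (tensor_kernel R Omega S M #>\<^bsub>free_Abelian_group (carrier S \<times> carrier M)\<^esub> z)
    = tensor_kernel R Omega T M #>\<^bsub>free_Abelian_group (carrier T \<times> carrier M)\<^esub> formal_map f z"
proof -
  interpret S: tensor_pair K R Omega lam P S M using assms by (simp add: tensor_pair_def)
  interpret T: tensor_pair K R Omega lam P T M using assms by (simp add: tensor_pair_def)
  have h: "formal_map f \<in> hom S.formal_sums T.formal_sums"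
    by (rule formal_map_hom) (use right_rb_homD(1)[OF f] in auto)
  let ?q = "\<lambda>z. T.relators #>\<^bsub>T.formal_sums\<^esub> formal_map f z"
  have eq: "?q y = ?q z" if y: "y \<in> S.relators #>\<^bsub>S.formal_sums\<^esub> z" for y
  proof -
    obtain k where k: "k \<in> S.relators" "y = k + z" using y by (auto simp: r_coset_def)
    then have kc: "k \<in> carrier S.formal_sums"
      using subgroup.mem_carrier[OF S.relators_subgroup] by blast
    have yc: "y \<in> carrier S.formal_sums"
      using group.is_monoid[OF group_free_Abelian_group, THEN monoid.m_closed, OF kc z] k by simp
    have "formal_map f y - formal_map f z \<in> T.relators"
      using formal_map_relators[OF assms(1-4) k(1)] k(2) by (simp add: formal_map_add)
    then show ?thesis
      using T.coset_eq_iff hom_in_carrier[OF h yc] hom_in_carrier[OF h z] by blast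
  qed
  have "z \<in> S.relators #>\<^bsub>S.formal_sums\<^esub> z"
    by (rule group.rcos_self[OF group_free_Abelian_group z S.relators_subgroup])
  then have "?q ` (S.relators #>\<^bsub>S.formal_sums\<^esub> z) = {?q z}"
    using eq by blast
  then show ?thesis by (simp add: tensor_map_def formal_map_def)
qed

lemma tensor_map_hom:
  assumes "right_rb_module K R Omega lam P S" "right_rb_module K R Omega lam P T"
    and "left_rb_module K R Omega lam P M" and f: "f \<in> right_rb_hom R Omega S T"
  shows "tensor_map R Omega T M f \<in> hom (tensor_product R Omega S M) (tensor_product R Omega T M)"
proof -
  interpret S: tensor_pair K R Omega lam P S M using assms by (simp add: tensor_pair_def)
  interpret T: tensor_pair K R Omega lam P T M using assms by (simp add: tensor_pair_def)
  have h: "formal_map f \<in> hom S.formal_sums T.formal_sums"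
    by (rule formal_map_hom) (use right_rb_homD(1)[OF f] in auto)
  interpret NS: normal S.relators S.formal_sums by (rule S.relators_normal)
  interpret NT: normal T.relators T.formal_sums by (rule T.relators_normal)
  note coset = tensor_map_coset[OF assms]
  show ?thesis
    unfolding tensor_product_def
  proof (rule homI)
    fix C assume "C \<in> carrier (S.formal_sums Mod S.relators)"
    then obtain z where z: "z \<in> carrier S.formal_sums" "C = S.relators #>\<^bsub>S.formal_sums\<^esub> z"
      by (auto simp: carrier_FactGroup)
    then show "tensor_map R Omega T M f C \<in> carrier (T.formal_sums Mod T.relators)"
      using hom_in_carrier[OF h] unfolding carrier_FactGroup z(2) coset[OF z(1)] by blast
    fix D assume "D \<in> carrier (S.formal_sums Mod S.relators)"
    then obtain y where y: "y \<in> carrier S.formal_sums" "D = S.relators #>\<^bsub>S.formal_sums\<^esub> y"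
      by (auto simp: carrier_FactGroup)
    show "tensor_map R Omega T M f (C \<otimes>\<^bsub>S.formal_sums Mod S.relators\<^esub> D) =
        tensor_map R Omega T M f C \<otimes>\<^bsub>T.formal_sums Mod T.relators\<^esub> tensor_map R Omega T M f D"
      unfolding z(2) y(2) mult_FactGroup NS.rcos_sum[OF z(1) y(1)] coset[OF z(1)] coset[OF y(1)]
        coset[OF NS.m_closed[OF z(1) y(1)]]
        NT.rcos_sum[OF hom_in_carrier[OF h z(1)] hom_in_carrier[OF h y(1)]]
      by (simp add: formal_map_add)
  qed
qed

text \<open>Induced maps act on normal forms coefficient by coefficient. Exactness at each of the three
  places is therefore checked on coefficients, where it is the exactness of the given sequence; a
  normal form has finitely many coefficients, and preimages are chosen for each of them.\<close>

theorem free_left_rb_module_tensor_short_exact: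
  fixes basis :: "'x set" and F :: "('r, 'w, 'f, 'd) left_op_module_scheme"
  assumes A: "right_rb_module K R Omega lam P A" and B: "right_rb_module K R Omega lam P B"
    and C: "right_rb_module K R Omega lam P C"
    and free: "free_left_rb_module TYPE(('r, 'w, 'x, 'f) test_universe) K R Omega lam P basis F j"
    and f: "f \<in> right_rb_hom R Omega A B" and g: "g \<in> right_rb_hom R Omega B C"
    and exact: "short_exact (add_monoid A) (add_monoid B) (add_monoid C) f g"
  shows "short_exact (tensor_product R Omega A F) (tensor_product R Omega B F)
    (tensor_product R Omega C F) (tensor_map R Omega B F f) (tensor_map R Omega C F g)"
proof -
  have F: "left_rb_module K R Omega lam P F" using free by (simp add: free_left_rb_module_def)
  interpret A: free_tensor_pair K R Omega lam P A F basis j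
    using A F free by (simp add: free_tensor_pair_def free_tensor_pair_axioms_def tensor_pair_def)
  interpret B: free_tensor_pair K R Omega lam P B F basis j
    using B F free by (simp add: free_tensor_pair_def free_tensor_pair_axioms_def tensor_pair_def)
  interpret C: free_tensor_pair K R Omega lam P C F basis j
    using C F free by (simp add: free_tensor_pair_def free_tensor_pair_axioms_def tensor_pair_def)
  have f_inj: "inj_on f (carrier A)" and g_surj: "g ` carrier B = carrier C"
    and ker: "f ` carrier A = {b \<in> carrier B. g b = \<zero>\<^bsub>C\<^esub>}"
    using exact by (auto simp: short_exact_def mon_def epi_def kernel_def)
  have f0: "f \<zero>\<^bsub>A\<^esub> = \<zero>\<^bsub>B\<^esub>"
    using f by (intro add_monoid_hom_zero A.S.N.S.abelian_group_axioms B.S.N.S.abelian_group_axioms)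
      (simp add: right_rb_hom_def)
  have fc: "f a \<in> carrier B" if "a \<in> carrier A" for a using right_rb_homD(1)[OF f that] .
  have gc: "g b \<in> carrier C" if "b \<in> carrier B" for b using right_rb_homD(1)[OF g that] .
  have fm: "formal_map f z \<in> carrier B.formal_sums" if "z \<in> carrier A.formal_sums" for z
    by (rule hom_in_carrier[OF formal_map_hom that]) (use fc in auto)
  have gm: "formal_map g z \<in> carrier C.formal_sums" if "z \<in> carrier B.formal_sums" for z
    by (rule hom_in_carrier[OF formal_map_hom that]) (use gc in auto)
  have fcong: "formal_map f z - formal_map f z' \<in> B.relators" if "z - z' \<in> A.relators" for z z'
    using formal_map_relators[OF A B F f that] by (simp add: formal_map_diff)
  have gcong: "formal_map g z - formal_map g z' \<in> C.relators" if "z - z' \<in> B.relators" for z z'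
    using formal_map_relators[OF B C F g that] by (simp add: formal_map_diff)
  note fcoset = tensor_map_coset[OF A B F f] and gcoset = tensor_map_coset[OF B C F g]
  note carrier = tensor_product_def carrier_FactGroup
  have grA: "group (tensor_product R Omega A F)" and grB: "group (tensor_product R Omega B F)"
    and grC: "group (tensor_product R Omega C F)"
    unfolding tensor_product_def
    by (rule normal.factorgroup_is_group, rule A.relators_normal B.relators_normal C.relators_normal)+

  have inj: "z \<in> A.relators" if z: "z \<in> carrier A.formal_sums" and fz: "formal_map f z \<in> B.relators" for z
  proof -
    obtain I u where I: "finite I" "I \<subseteq> basis" "u \<in> I \<rightarrow> carrier A" "z - basis_sum j u I \<in> A.relators"
      by (rule A.normal_form[OF z])
    have "basis_sum j (f \<circ> u) I \<in> B.relators"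
      using B.in_relators_iff[OF fcong[OF I(4)]] fz by (simp add: formal_map_basis_sum I(1))
    then have "\<forall>x\<in>I. f (u x) = f \<zero>\<^bsub>A\<^esub>"
      using B.basis_sum_in_relators_iff[of I "f \<circ> u"] I fc by (auto simp: f0 Pi_iff)
    then have "\<forall>x\<in>I. u x = \<zero>\<^bsub>A\<^esub>"
      using inj_onD[OF f_inj] I(3) by auto
    then show ?thesis
      using A.in_relators_iff[OF I(4)] A.basis_sum_in_relators_iff[OF I(1-3)] by blast
  qed

  have mid: "\<exists>y\<in>carrier A.formal_sums. z - formal_map f y \<in> B.relators"
    if z: "z \<in> carrier B.formal_sums" and gz: "formal_map g z \<in> C.relators" for z
  proof -
    obtain I u where I: "finite I" "I \<subseteq> basis" "u \<in> I \<rightarrow> carrier B" "z - basis_sum j u I \<in> B.relators"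
      by (rule B.normal_form[OF z])
    have "basis_sum j (g \<circ> u) I \<in> C.relators"
      using C.in_relators_iff[OF gcong[OF I(4)]] gz by (simp add: formal_map_basis_sum I(1))
    then have "\<forall>x\<in>I. g (u x) = \<zero>\<^bsub>C\<^esub>"
      using C.basis_sum_in_relators_iff[of I "g \<circ> u"] I gc by (auto simp: Pi_iff)
    then have "\<forall>x\<in>I. u x \<in> f ` carrier A"
      using I(3) by (auto simp: ker)
    then have "\<forall>x\<in>I. \<exists>a\<in>carrier A. u x = f a" by blast
    then obtain a where a: "\<forall>x\<in>I. a x \<in> carrier A \<and> u x = f (a x)"
      by metis
    then have "basis_sum j u I = formal_map f (basis_sum j a I)"
      by (simp add: formal_map_basis_sum I(1)) (rule basis_sum_cong, simp)
    moreover have "basis_sum j a I \<in> carrier A.formal_sums"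
      by (rule A.basis_sum_in_formal_sums) (use I a in auto)
    ultimately show ?thesis using I(4) by metis
  qed

  have comp: "formal_map g (formal_map f y) \<in> C.relators" if y: "y \<in> carrier A.formal_sums" for y
  proof -
    obtain I u where I: "finite I" "I \<subseteq> basis" "u \<in> I \<rightarrow> carrier A" "y - basis_sum j u I \<in> A.relators"
      by (rule A.normal_form[OF y])
    have gf: "g (f a) = \<zero>\<^bsub>C\<^esub>" if "a \<in> carrier A" for a using ker that by blast
    have "basis_sum j (g \<circ> (f \<circ> u)) I \<in> C.relators"
      by (rule C.basis_sum_in_relators_iff[THEN iffD2]) (use I ker C.S.N.S.zero_closed in \<open>auto simp: Pi_iff gf\<close>)
    then show ?thesis
      using C.in_relators_iff[OF gcong[OF fcong[OF I(4)]]] by (simp add: formal_map_basis_sum I(1))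
  qed

  have surj: "\<exists>y\<in>carrier B.formal_sums. z - formal_map g y \<in> C.relators"
    if z: "z \<in> carrier C.formal_sums" for z
  proof -
    obtain I u where I: "finite I" "I \<subseteq> basis" "u \<in> I \<rightarrow> carrier C" "z - basis_sum j u I \<in> C.relators"
      by (rule C.normal_form[OF z])
    then have "\<forall>x\<in>I. \<exists>b\<in>carrier B. u x = g b"
      using g_surj by blast
    then obtain b where b: "\<forall>x\<in>I. b x \<in> carrier B \<and> u x = g (b x)"
      by metis
    then have "basis_sum j u I = formal_map g (basis_sum j b I)"
      by (simp add: formal_map_basis_sum I(1)) (rule basis_sum_cong, simp)
    moreover have "basis_sum j b I \<in> carrier B.formal_sums"
      by (rule B.basis_sum_in_formal_sums) (use I b in auto)
    ultimately show ?thesis using I(4) by metis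
  qed

  have "tensor_map R Omega B F f \<in> mon (tensor_product R Omega A F) (tensor_product R Omega B F)"
  proof -
    have "inj_on (tensor_map R Omega B F f) (carrier (tensor_product R Omega A F))"
    proof (rule inj_onI)
      fix X Y assume "X \<in> carrier (tensor_product R Omega A F)" "Y \<in> carrier (tensor_product R Omega A F)"
      then obtain x y where x: "x \<in> carrier A.formal_sums" "X = A.relators #>\<^bsub>A.formal_sums\<^esub> x"
        and y: "y \<in> carrier A.formal_sums" "Y = A.relators #>\<^bsub>A.formal_sums\<^esub> y"
        unfolding carrier by blast
      have xy: "x - y \<in> carrier A.formal_sums" using x(1) y(1) keys_diff[of x y] by auto
      assume "tensor_map R Omega B F f X = tensor_map R Omega B F f Y"
      then have "formal_map f (x - y) \<in> B.relators"
        unfolding x(2) y(2) fcoset[OF x(1)] fcoset[OF y(1)] B.coset_eq_iff[OF fm[OF x(1)] fm[OF y(1)]]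
        by (simp add: formal_map_diff)
      then show "X = Y"
        unfolding x(2) y(2) A.coset_eq_iff[OF x(1) y(1)] by (rule inj[OF xy])
    qed
    then show ?thesis by (simp add: mon_def tensor_map_hom[OF A B F f])
  qed
  moreover have "tensor_map R Omega C F g \<in> epi (tensor_product R Omega B F) (tensor_product R Omega C F)"
  proof -
    have "carrier (tensor_product R Omega C F) \<subseteq> tensor_map R Omega C F g ` carrier (tensor_product R Omega B F)"
    proof
      fix Z assume "Z \<in> carrier (tensor_product R Omega C F)"
      then obtain z where z: "z \<in> carrier C.formal_sums" "Z = C.relators #>\<^bsub>C.formal_sums\<^esub> z"
        unfolding carrier by blast
      obtain y where y: "y \<in> carrier B.formal_sums" "z - formal_map g y \<in> C.relators"
        using surj[OF z(1)] by blast
      have "Z = tensor_map R Omega C F g (B.relators #>\<^bsub>B.formal_sums\<^esub> y)"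
        unfolding z(2) gcoset[OF y(1)] C.coset_eq_iff[OF z(1) gm[OF y(1)]] by (rule y(2))
      then show "Z \<in> tensor_map R Omega C F g ` carrier (tensor_product R Omega B F)"
        using y(1) unfolding carrier by blast
    qed
    then show ?thesis
      using tensor_map_hom[OF B C F g] hom_in_carrier[OF tensor_map_hom[OF B C F g]]
      by (auto simp: epi_def)
  qed
  moreover have "tensor_map R Omega B F f ` carrier (tensor_product R Omega A F)
      = kernel (tensor_product R Omega B F) (tensor_product R Omega C F) (tensor_map R Omega C F g)"
  proof -
    have one: "tensor_map R Omega C F g (B.relators #>\<^bsub>B.formal_sums\<^esub> z) = \<one>\<^bsub>tensor_product R Omega C F\<^esub>
        \<longleftrightarrow> formal_map g z \<in> C.relators" if z: "z \<in> carrier B.formal_sums" for z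
    proof -
      have zero: "0 \<in> carrier C.formal_sums" by simp
      have "\<one>\<^bsub>tensor_product R Omega C F\<^esub> = C.relators #>\<^bsub>C.formal_sums\<^esub> 0"
        using subgroup.rcos_const[OF C.relators_subgroup group_free_Abelian_group C.relators_zero]
        by (simp add: tensor_product_def)
      then show ?thesis
        by (simp only: gcoset[OF z] C.coset_eq_iff[OF gm[OF z] zero] diff_zero)
    qed
    show ?thesis
    proof (intro subset_antisym subsetI)
      fix Z assume "Z \<in> tensor_map R Omega B F f ` carrier (tensor_product R Omega A F)"
      then obtain y where y: "y \<in> carrier A.formal_sums"
        "Z = tensor_map R Omega B F f (A.relators #>\<^bsub>A.formal_sums\<^esub> y)"
        unfolding carrier by blast
      then have Z: "Z = B.relators #>\<^bsub>B.formal_sums\<^esub> formal_map f y" using fcoset by simp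
      then have "Z \<in> carrier (tensor_product R Omega B F)"
        using fm[OF y(1)] unfolding carrier by blast
      then show "Z \<in> kernel (tensor_product R Omega B F) (tensor_product R Omega C F) (tensor_map R Omega C F g)"
        using one[OF fm[OF y(1)]] comp[OF y(1)] by (simp add: kernel_def Z)
    next
      fix Z assume "Z \<in> kernel (tensor_product R Omega B F) (tensor_product R Omega C F) (tensor_map R Omega C F g)"
      then have "Z \<in> carrier (tensor_product R Omega B F)"
        and gZ: "tensor_map R Omega C F g Z = \<one>\<^bsub>tensor_product R Omega C F\<^esub>"
        by (simp_all add: kernel_def)
      then obtain z where z: "z \<in> carrier B.formal_sums" "Z = B.relators #>\<^bsub>B.formal_sums\<^esub> z"
        unfolding carrier by blast
      obtain y where y: "y \<in> carrier A.formal_sums" "z - formal_map f y \<in> B.relators"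
        using mid[OF z(1)] one[OF z(1)] gZ z(2) by blast
      have "Z = tensor_map R Omega B F f (A.relators #>\<^bsub>A.formal_sums\<^esub> y)"
        unfolding z(2) fcoset[OF y(1)] B.coset_eq_iff[OF z(1) fm[OF y(1)]] by (rule y(2))
      then show "Z \<in> tensor_map R Omega B F f ` carrier (tensor_product R Omega A F)"
        using y(1) unfolding carrier by blast
    qed
  qed
  ultimately show ?thesis
    unfolding short_exact_def using grA grB grC by blast
qed

theorem theorem4p11:
  fixes K :: "'k ring" and R :: "('k, 'r) module"
    and Omega :: "'w set" and lam :: "'w \<Rightarrow> 'k" and P :: "'w \<Rightarrow> 'r \<Rightarrow> 'r"
    and basis :: "'x set" and F :: "('r, 'w, 'f) left_op_module" and j :: "'x \<Rightarrow> 'f"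
  assumes "multiple_rota_baxter_algebra K R Omega lam P"
    and "free_left_rb_module TYPE(('r, 'w, 'x, 'f) test_universe) K R Omega lam P basis F j"
  shows "flat_left_rb_module TYPE('a) TYPE('b) TYPE('c) K R Omega lam P F"
proof -
  have "left_rb_module K R Omega lam P F"
    using assms(2) by (simp add: free_left_rb_module_def)
  then show ?thesis
    unfolding flat_left_rb_module_def
    using free_left_rb_module_tensor_short_exact[OF _ _ _ assms(2)] by blast
qed

end
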